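(* For any $\varepsilon>0$ there exists $\gamma>0$ such that for all sufficiently large $t$ (depending on $\varepsilon$) and all sufficiently large $N$ (depending on $t,\varepsilon$), $$\mathbb{P}\left(\max_{0\le s\le t}\frac{T_N^*(s)-4N}{2^{4/3}N^{1/3}(\log t)^{2/3}}\ge\left(\frac34\right)^{2/3}(1+\varepsilon)\right)\le t^{-\gamma}.$$
   Context: Put i.i.d. $\mathrm{Exp}(1)$ weights on the vertices of $\mathbb{Z}^2$. For $s\in\mathbb{R}$ and $N\in\mathbb{N}$ let $u_N(s)=(N-\lfloor s(2N)^{2/3}\rfloor,\,N+\lfloor s(2N)^{2/3}\rfloor)\in\mathbb{Z}^2$. Let $T^*_N(s)$ be the last passage time from the line $\mathcal{L}_0=\{x+y=0\}$ to $u_N(s)$, i.e. the maximal total weight (excluding the weight of the last vertex) among all up/right lattice paths that start at some lattice point of $\mathcal{L}_0$ and end at $u_N(s)$. *)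

theory Defs
  imports "HOL-Probability.Probability"
begin

definition antidiag :: "(int \<times> int) set" where
  "antidiag = {(x, y). x + y = 0}"

text \<open>A path is the list of its successive vertices; a single vertex is a path.\<close>

definition up_right_path :: "(int \<times> int) list \<Rightarrow> bool" where
  "up_right_path p \<longleftrightarrow>
     p \<noteq> [] \<and> successively (\<lambda>u v. v - u \<in> {(1, 0), (0, 1)}) p"

definition line_to_point_paths :: "int \<times> int \<Rightarrow> (int \<times> int) list set" where
  "line_to_point_paths v = {p. up_right_path p \<and> hd p \<in> antidiag \<and> last p = v}"

text \<open>The weight of the last vertex is excluded, hence \<^term>\<open>butlast\<close>.\<close>

definition path_weight :: "(int \<times> int \<Rightarrow> real) \<Rightarrow> (int \<times> int) list \<Rightarrow> real" where
  "path_weight w p = (\<Sum>v\<leftarrow>butlast p. w v)"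

definition line_to_point_lpp :: "(int \<times> int \<Rightarrow> real) \<Rightarrow> int \<times> int \<Rightarrow> real" where
  "line_to_point_lpp w v = Max (path_weight w ` line_to_point_paths v)"

definition endpoint :: "nat \<Rightarrow> real \<Rightarrow> int \<times> int" where
  "endpoint N s =
     (int N - \<lfloor>s * (2 * real N) powr (2/3)\<rfloor>, int N + \<lfloor>s * (2 * real N) powr (2/3)\<rfloor>)"

definition T_star :: "(int \<times> int \<Rightarrow> real) \<Rightarrow> nat \<Rightarrow> real \<Rightarrow> real" where
  "T_star w N s = line_to_point_lpp w (endpoint N s)"

text \<open>The maxima over paths and over \<open>0 \<le> s \<le> t\<close> range over finite nonempty sets of
  values, so that \<^const>\<open>Max\<close> is the genuine maximum.\<close>

lemma up_right_path_level:
  assumes "up_right_path p"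
  shows "fst (last p) + snd (last p) = fst (hd p) + snd (hd p) + int (length p - 1)"
  using assms
proof (induction p rule: rev_induct)
  case Nil
  then show ?case by (simp add: up_right_path_def)
next
  case (snoc v q)
  show ?case
  proof (cases "q = []")
    case False
    with snoc.prems have "up_right_path q" and "v - last q \<in> {(1, 0), (0, 1)}"
      by (auto simp: up_right_path_def successively_append_iff)
    moreover from this have "fst v + snd v = fst (last q) + snd (last q) + 1"
      by (cases v; cases "last q") (auto simp: algebra_simps)
    ultimately show ?thesis
      using snoc.IH False by (cases q) auto
  qed simp
qed

lemma finite_line_to_point_paths: "finite (line_to_point_paths v)"
proof -
  have "finite {p. length p = n \<and> up_right_path p \<and> last p = v}" for n
  proof (induction n arbitrary: v)
    case 0
    then show ?case by simp
  next
    case (Suc n)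
    let ?P = "\<lambda>v. {p. length p = n \<and> up_right_path p \<and> last p = v}"
    have "{p. length p = Suc n \<and> up_right_path p \<and> last p = v} \<subseteq>
          insert [v] ((\<lambda>q. q @ [v]) ` (?P (v - (1, 0)) \<union> ?P (v - (0, 1))))"
    proof
      fix p assume p: "p \<in> {p. length p = Suc n \<and> up_right_path p \<and> last p = v}"
      then obtain q where q: "p = q @ [v]"
        by (auto simp: up_right_path_def dest: append_butlast_last_id[symmetric])
      show "p \<in> insert [v] ((\<lambda>q. q @ [v]) ` (?P (v - (1, 0)) \<union> ?P (v - (0, 1))))"
      proof (cases "q = []")
        case False
        with p q have path: "up_right_path q" and step: "v - last q \<in> {(1, 0), (0, 1)}"
          by (auto simp: up_right_path_def successively_append_iff)
        have "last q = v - (v - last q)" by simp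
        with step have "last q = v - (1, 0) \<or> last q = v - (0, 1)" by (metis insertE singletonD)
        with p q path have "q \<in> ?P (v - (1, 0)) \<union> ?P (v - (0, 1))" by simp
        with q show ?thesis by blast
      qed (simp add: q)
    qed
    then show ?case
      by (rule finite_subset) (use Suc.IH in auto)
  qed
  moreover have "line_to_point_paths v \<subseteq>
      {p. length p = nat (fst v + snd v + 1) \<and> up_right_path p \<and> last p = v}"
  proof
    fix p assume p: "p \<in> line_to_point_paths v"
    then have "fst v + snd v = int (length p - 1)" "p \<noteq> []"
      using up_right_path_level[of p]
      by (auto simp: line_to_point_paths_def antidiag_def up_right_path_def)
    then have "length p = nat (fst v + snd v + 1)"
      by (cases p) auto
    with p show "p \<in> {p. length p = nat (fst v + snd v + 1) \<and> up_right_path p \<and> last p = v}"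
      by (simp add: line_to_point_paths_def)
  qed
  ultimately show ?thesis
    by (blast intro: finite_subset)
qed

lemma line_to_point_paths_nonempty:
  assumes "fst v + snd v = int n"
  shows "line_to_point_paths v \<noteq> {}"
  using assms
proof (induction n arbitrary: v)
  case 0
  then have "[v] \<in> line_to_point_paths v"
    by (cases v) (auto simp: line_to_point_paths_def up_right_path_def antidiag_def)
  then show ?case by blast
next
  case (Suc n)
  then have "fst (v - (1, 0)) + snd (v - (1, 0)) = int n" by simp
  from Suc.IH[OF this] obtain q where "q \<in> line_to_point_paths (v - (1, 0))" by blast
  then have "q @ [v] \<in> line_to_point_paths v"
    by (auto simp: line_to_point_paths_def up_right_path_def successively_append_iff)
  then show ?case by blast
qed

lemma line_to_point_paths_endpoint_nonempty: "line_to_point_paths (endpoint N s) \<noteq> {}"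
  by (rule line_to_point_paths_nonempty[where n = "2 * N"]) (simp add: endpoint_def)

lemma finite_T_star_range: "finite (T_star w N ` {0..t})"
proof -
  let ?c = "(2 * real N) powr (2/3)"
  have "(\<lambda>s. \<lfloor>s * ?c\<rfloor>) ` {0..t} \<subseteq> {0..\<lfloor>t * ?c\<rfloor>}"
    by (auto intro!: floor_mono mult_right_mono)
  then have "finite ((\<lambda>s. \<lfloor>s * ?c\<rfloor>) ` {0..t})"
    by (rule finite_subset) simp
  then have "finite ((\<lambda>k. line_to_point_lpp w (int N - k, int N + k)) ` (\<lambda>s. \<lfloor>s * ?c\<rfloor>) ` {0..t})"
    by (rule finite_imageI)
  then show ?thesis
    by (simp add: image_image T_star_def endpoint_def)
qed

end

theory Submission
  imports Defs "HOL-Real_Asymp.Real_Asymp"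
begin

text \<open>
  Start the last passage recursion from a random walk \<open>S\<close> with increments \<open>I - J\<close>, where
  \<open>I \<sim> Exp(a)\<close>, \<open>J \<sim> Exp(b)\<close> and \<open>a = (1 + \<theta>) / 2\<close>, \<open>b = (1 - \<theta>) / 2\<close>. As \<open>a + b = 1\<close>, Burke's theorem makes the
  increments stationary, and after \<open>n\<close> levels the profile is \<open>S\<close> shifted by an independent
  sum of \<open>n\<close> variables \<open>Exp(a)\<close>. As \<open>a - b = \<theta>\<close>, every \<open>\<E> exp (\<theta> S\<^sub>k)\<close> equals 1; conditioning on the
  weights, hence on the optimal starting point, shows that starting from \<open>S\<close> instead of from 0
  can only increase \<open>\<E> exp (\<theta> max\<^sub>j T\<^sub>j)\<close>. This gives
  \<open>\<E> exp (\<theta> max\<^sub>j\<^sub>\<le>\<^sub>m T\<^sub>j) \<le> ((1 + \<theta>) / (1 - \<theta>))\<^sup>n \<E> max\<^sub>j\<^sub>\<le>\<^sub>m exp (\<theta> S\<^sub>j)\<close>.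
  With \<open>n = 2N\<close> and \<open>\<theta> = \<tau> N\<^sup>-\<^sup>1\<^sup>/\<^sup>3\<close> the first factor is about \<open>exp (4N\<theta> + 4\<tau>\<^sup>3/3)\<close>, while for \<open>m\<close> of order
  \<open>N\<^sup>2\<^sup>/\<^sup>3\<close> the second is only \<open>exp (O(\<tau>\<^sup>2))\<close>. Chernoff's bound with \<open>\<tau>\<^sup>3 = 3/8 ln t\<close> then gives
  \<open>t\<^sup>-\<^sup>1\<^sup>-\<^sup>3\<^sup>\<epsilon>\<^sup>/\<^sup>2\<^sup>+\<^sup>o\<^sup>(\<^sup>1\<^sup>)\<close> for each of the \<open>O(t)\<close> windows of \<open>N\<^sup>2\<^sup>/\<^sup>3\<close> end points.
\<close>

subsection \<open>Burke's theorem for exponential weights\<close>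

definition expM :: "real \<Rightarrow> real measure" where
  "expM l = density lborel (\<lambda>x. ennreal (exponential_density l x))"

lemma sets_expM [simp, measurable_cong]: "sets (expM l) = sets borel"
  by (simp add: expM_def)

lemma space_expM [simp]: "space (expM l) = UNIV"
  by (simp add: expM_def)

lemma prob_space_expM: "0 < l \<Longrightarrow> prob_space (expM l)"
  by (simp add: expM_def prob_space_exponential_density)

lemma nn_integral_expM:
  "f \<in> borel_measurable borel \<Longrightarrow>
    (\<integral>\<^sup>+x. f x \<partial>expM l) = (\<integral>\<^sup>+x. ennreal (exponential_density l x) * f x \<partial>lborel)"
  unfolding expM_def by (subst nn_integral_density) auto

lemma nn_integral_exponential_density: "0 < l \<Longrightarrow> (\<integral>\<^sup>+x. ennreal (exponential_density l x) \<partial>lborel) = 1"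
  using nn_integral_expM[of "\<lambda>_. 1" l] prob_space.emeasure_space_1[OF prob_space_expM[of l]] by simp

lemma nn_integral_exp_expM:
  assumes "0 < l" "s < l"
  shows "(\<integral>\<^sup>+x. ennreal (exp (s * x)) \<partial>expM l) = ennreal (l / (l - s))"
proof -
  have "ennreal (exponential_density l x) * ennreal (exp (s * x))
      = ennreal (l / (l - s)) * ennreal (exponential_density (l - s) x)" for x
  proof -
    have "exp (- (x * l)) * exp (s * x) = exp (- (x * (l - s)))"
      by (simp add: exp_add[symmetric] algebra_simps)
    then show ?thesis
      using assms by (simp add: exponential_density_def ennreal_mult[symmetric])
  qed
  then have "(\<integral>\<^sup>+x. ennreal (exp (s * x)) \<partial>expM l)
      = (\<integral>\<^sup>+x. ennreal (l / (l - s)) * ennreal (exponential_density (l - s) x) \<partial>lborel)"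
    by (subst nn_integral_expM) auto
  also have "\<dots> = ennreal (l / (l - s))"
    using assms by (subst nn_integral_cmult) (auto simp: nn_integral_exponential_density)
  finally show ?thesis .
qed

lemma nn_integral_swap:
  assumes "sigma_finite_measure M" "sigma_finite_measure N"
    and "(\<lambda>(x, y). f x y) \<in> borel_measurable (M \<Otimes>\<^sub>M N)"
  shows "(\<integral>\<^sup>+x. \<integral>\<^sup>+y. f x y \<partial>N \<partial>M) = (\<integral>\<^sup>+y. \<integral>\<^sup>+x. f x y \<partial>M \<partial>N)"
proof -
  interpret M: sigma_finite_measure M by fact
  interpret N: sigma_finite_measure N by fact
  interpret pair_sigma_finite M N ..
  show ?thesis by (rule Fubini'[symmetric]) (use assms in simp)
qed

lemma sigma_finite_lborel: "sigma_finite_measure lborel"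
  by unfold_locales

lemma lborel_Fubini:
  fixes f :: "real \<Rightarrow> real \<Rightarrow> ennreal"
  assumes "case_prod f \<in> borel_measurable (borel \<Otimes>\<^sub>M borel)"
  shows "(\<integral>\<^sup>+x. \<integral>\<^sup>+y. f x y \<partial>lborel \<partial>lborel) = (\<integral>\<^sup>+y. \<integral>\<^sup>+x. f x y \<partial>lborel \<partial>lborel)"
  by (rule nn_integral_swap[OF sigma_finite_lborel sigma_finite_lborel]) (use assms in simp)

lemma lborel_shift:
  fixes f :: "real \<Rightarrow> ennreal"
  assumes [measurable]: "f \<in> borel_measurable borel"
  shows "(\<integral>\<^sup>+x. f x \<partial>lborel) = (\<integral>\<^sup>+x. f (x + c) \<partial>lborel)"
  using nn_integral_real_affine[of f 1 c] by (simp add: add.commute)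

text \<open>With \<open>u = i - j\<close> the density
  \<open>a * exp (- a * (u + j)) * b * exp (- b * j)\<close> splits as
  \<open>a * b * exp (- a * u)\<close> times the Exp(1) density at \<open>j\<close>, because
  \<open>a + b = 1\<close>. So \<open>j\<close> is independent of \<open>u\<close> and may be
  exchanged for the fresh weight \<open>w\<close>; reading the factorization backwards gives
  \<open>(w + u, w)\<close> the law of \<open>(i, j)\<close>. The set \<open>P\<close> is kept
  general so that the diagonal can be assigned to either half.\<close>

lemma burke_half:
  fixes F :: "real \<Rightarrow> real \<Rightarrow> ennreal"
  assumes ab: "0 < a" "0 < b" "a + b = 1" and P: "P \<subseteq> {0..}" "P \<in> sets borel"
    and F: "case_prod F \<in> borel_measurable (borel \<Otimes>\<^sub>M borel)"
  shows "(\<integral>\<^sup>+i. \<integral>\<^sup>+j. \<integral>\<^sup>+w. indicator P (i - j) * F (w + (i - j)) w \<partial>expM 1 \<partial>expM b \<partial>expM a)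
       = (\<integral>\<^sup>+i. \<integral>\<^sup>+j. indicator P (i - j) * F i j \<partial>expM b \<partial>expM a)"
proof -
  note [measurable] = P(2)
  define e where "e l x = ennreal (exponential_density l x)" for l x
  have [measurable]: "e l \<in> borel_measurable borel" for l by (simp add: e_def[abs_def])
  have FF[measurable]: "(\<lambda>x. F (f x) (g x)) \<in> borel_measurable N"
    if "f \<in> borel_measurable N" "g \<in> borel_measurable N" for f g and N :: "'z measure"
    using measurable_compose[OF measurable_Pair[OF that] F] by simp
  have "(\<integral>\<^sup>+i. \<integral>\<^sup>+j. \<integral>\<^sup>+w. indicator P (i - j) * F (w + (i - j)) w \<partial>expM 1 \<partial>expM b \<partial>expM a)
      = (\<integral>\<^sup>+i. \<integral>\<^sup>+j. \<integral>\<^sup>+w. e a i * e b j * e 1 w * indicator P (i - j) * F (w + (i - j)) w \<partial>lborel \<partial>lborel \<partial>lborel)"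
    by (simp add: nn_integral_expM e_def nn_integral_cmult[symmetric] mult_ac)
  also have "\<dots> = (\<integral>\<^sup>+j. \<integral>\<^sup>+i. \<integral>\<^sup>+w. e a i * e b j * e 1 w * indicator P (i - j) * F (w + (i - j)) w \<partial>lborel \<partial>lborel \<partial>lborel)"
    by (rule lborel_Fubini) measurable
  also have "\<dots> = (\<integral>\<^sup>+j. \<integral>\<^sup>+u. \<integral>\<^sup>+w. e a (u + j) * e b j * e 1 w * indicator P u * F (w + u) w \<partial>lborel \<partial>lborel \<partial>lborel)"
  proof (rule nn_integral_cong)
    fix j :: real
    show "(\<integral>\<^sup>+i. \<integral>\<^sup>+w. e a i * e b j * e 1 w * indicator P (i - j) * F (w + (i - j)) w \<partial>lborel \<partial>lborel)
        = (\<integral>\<^sup>+u. \<integral>\<^sup>+w. e a (u + j) * e b j * e 1 w * indicator P u * F (w + u) w \<partial>lborel \<partial>lborel)"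
      by (subst lborel_shift[where c=j]) auto
  qed
  \<comment> \<open>The Exp(1) factor in \<open>j\<close> is isolated; its integral is 1, so
    \<open>j\<close> disappears.\<close>
  also have "\<dots> = (\<integral>\<^sup>+j. e 1 j * (\<integral>\<^sup>+u. \<integral>\<^sup>+w. ennreal (a * b * exp (- a * u)) * e 1 w * indicator P u * F (w + u) w \<partial>lborel \<partial>lborel) \<partial>lborel)"
  proof (intro nn_integral_cong)
    fix j :: real
    have *: "e a (u + j) * e b j * indicator P u = e 1 j * (ennreal (a * b * exp (- a * u)) * indicator P u)" for u
    proof (cases "u \<in> P \<and> 0 \<le> j")
      case True
      then have "0 \<le> u" "0 \<le> j" using P by auto
      moreover have "exp (a * (- u - j)) * exp (- (b * j)) = exp (- j) * exp (- (a * u))"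
      proof -
        have "a * (- u - j) + - (b * j) = - j * (a + b) + - (a * u)" by (simp add: algebra_simps)
        then show ?thesis using ab(3) by (simp add: exp_add[symmetric])
      qed
      ultimately show ?thesis using ab True
        by (simp add: e_def exponential_density_def ennreal_mult[symmetric] mult_ac)
    next
      case False
      then show ?thesis by (auto simp: e_def exponential_density_def)
    qed
    have "(\<integral>\<^sup>+u. \<integral>\<^sup>+w. e a (u + j) * e b j * e 1 w * indicator P u * F (w + u) w \<partial>lborel \<partial>lborel)
       = (\<integral>\<^sup>+u. \<integral>\<^sup>+w. (e a (u + j) * e b j * indicator P u) * (e 1 w * F (w + u) w) \<partial>lborel \<partial>lborel)"
      by (simp add: mult_ac)
    also have "\<dots> = (\<integral>\<^sup>+u. \<integral>\<^sup>+w. e 1 j * (ennreal (a * b * exp (- a * u)) * e 1 w * indicator P u * F (w + u) w) \<partial>lborel \<partial>lborel)"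
      unfolding * by (simp add: mult_ac)
    also have "\<dots> = e 1 j * (\<integral>\<^sup>+u. \<integral>\<^sup>+w. ennreal (a * b * exp (- a * u)) * e 1 w * indicator P u * F (w + u) w \<partial>lborel \<partial>lborel)"
      by (simp add: nn_integral_cmult)
    finally show "(\<integral>\<^sup>+u. \<integral>\<^sup>+w. e a (u + j) * e b j * e 1 w * indicator P u * F (w + u) w \<partial>lborel \<partial>lborel) = \<dots>" .
  qed
  also have "\<dots> = (\<integral>\<^sup>+u. \<integral>\<^sup>+w. ennreal (a * b * exp (- a * u)) * e 1 w * indicator P u * F (w + u) w \<partial>lborel \<partial>lborel)"
    using nn_integral_exponential_density[of 1] by (subst nn_integral_multc) (auto simp: e_def[abs_def])
  also have "\<dots> = (\<integral>\<^sup>+w. \<integral>\<^sup>+u. ennreal (a * b * exp (- a * u)) * e 1 w * indicator P u * F (w + u) w \<partial>lborel \<partial>lborel)"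
    by (rule lborel_Fubini) measurable
  also have "\<dots> = (\<integral>\<^sup>+w. \<integral>\<^sup>+u. ennreal (a * b * exp (- a * (u - w))) * e 1 w * indicator P (u - w) * F u w \<partial>lborel \<partial>lborel)"
  proof (rule nn_integral_cong)
    fix w :: real
    show "(\<integral>\<^sup>+u. ennreal (a * b * exp (- a * u)) * e 1 w * indicator P u * F (w + u) w \<partial>lborel)
        = (\<integral>\<^sup>+u. ennreal (a * b * exp (- a * (u - w))) * e 1 w * indicator P (u - w) * F u w \<partial>lborel)"
      by (subst lborel_shift[where c="-w"]) auto
  qed
  \<comment> \<open>The same factorization in reverse, with \<open>w\<close> in the place of
    \<open>j\<close> and the larger variable renamed to \<open>u\<close>.\<close>
  also have "\<dots> = (\<integral>\<^sup>+w. \<integral>\<^sup>+u. e a u * e b w * indicator P (u - w) * F u w \<partial>lborel \<partial>lborel)"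
  proof (intro nn_integral_cong)
    fix w u :: real
    show "ennreal (a * b * exp (- a * (u - w))) * e 1 w * indicator P (u - w) * F u w
        = e a u * e b w * indicator P (u - w) * F u w"
    proof (cases "u - w \<in> P \<and> 0 \<le> w")
      case True
      then have "0 \<le> w" "0 \<le> u" using P by force+
      moreover have "exp (- (a * (u - w))) * exp (- w) = exp (- (u * a)) * exp (- (w * b))"
      proof -
        have "- (a * (u - w)) + - (w * (a + b)) = - (u * a) + - (w * b)" by (simp add: algebra_simps)
        then show ?thesis using ab(3) by (simp add: exp_add[symmetric])
      qed
      ultimately have "ennreal (a * b * exp (- a * (u - w))) * e 1 w = e a u * e b w" using ab
        by (simp add: e_def exponential_density_def ennreal_mult[symmetric] mult_ac)
      then show ?thesis by simp
    next
      case False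
      then show ?thesis by (auto simp: e_def exponential_density_def)
    qed
  qed
  also have "\<dots> = (\<integral>\<^sup>+u. \<integral>\<^sup>+w. e a u * e b w * indicator P (u - w) * F u w \<partial>lborel \<partial>lborel)"
    by (rule lborel_Fubini) measurable
  also have "\<dots> = (\<integral>\<^sup>+i. \<integral>\<^sup>+j. indicator P (i - j) * F i j \<partial>expM b \<partial>expM a)"
    by (simp add: nn_integral_expM e_def nn_integral_cmult[symmetric] mult_ac)
  finally show ?thesis .
qed

text \<open>At most one increment exceeds their minimum, which is \<open>Exp(1)\<close> and independent of the
  excesses; the step exchanges it for the fresh weight.\<close>

lemma burke_local:
  fixes F :: "real \<Rightarrow> real \<Rightarrow> ennreal"
  assumes ab: "0 < a" "0 < b" "a + b = 1"
    and F: "(\<lambda>(x, y). F x y) \<in> borel_measurable (borel \<Otimes>\<^sub>M borel)"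
  shows "(\<integral>\<^sup>+i. \<integral>\<^sup>+j. \<integral>\<^sup>+w. F (w + max 0 (i - j)) (w + max 0 (j - i)) \<partial>expM 1 \<partial>expM b \<partial>expM a)
       = (\<integral>\<^sup>+i. \<integral>\<^sup>+j. F i j \<partial>expM b \<partial>expM a)"
proof -
  have FF[measurable]: "(\<lambda>x. F (f x) (g x)) \<in> borel_measurable N"
    if "f \<in> borel_measurable N" "g \<in> borel_measurable N" for f g and N :: "'z measure"
    using measurable_compose[OF measurable_Pair[OF that] F] by simp
  interpret A: prob_space "expM a" using ab by (intro prob_space_expM)
  interpret B: prob_space "expM b" using ab by (intro prob_space_expM)
  interpret W: prob_space "expM 1" by (intro prob_space_expM) simp
  have swap: "(\<integral>\<^sup>+i. \<integral>\<^sup>+j. H i j \<partial>expM b \<partial>expM a) = (\<integral>\<^sup>+j. \<integral>\<^sup>+i. H i j \<partial>expM a \<partial>expM b)"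
    if "(\<lambda>(x, y). H x y) \<in> borel_measurable (borel \<Otimes>\<^sub>M borel)" for H :: "real \<Rightarrow> real \<Rightarrow> ennreal"
  proof (rule nn_integral_swap[OF A.sigma_finite_measure_axioms B.sigma_finite_measure_axioms])
    show "(\<lambda>(x, y). H x y) \<in> borel_measurable (expM a \<Otimes>\<^sub>M expM b)"
      using that by (simp cong: measurable_cong_sets sets_pair_measure_cong)
  qed
  \<comment> \<open>Ties \<open>i = j\<close> are counted in the first half only.\<close>
  have split: "F (w + max 0 (i - j)) (w + max 0 (j - i))
      = indicator {0..} (i - j) * F (w + (i - j)) w + indicator {0<..} (j - i) * F w (w + (j - i))" for i j w
    by (cases "j \<le> i") (auto simp: indicator_def)
  have split': "F i j = indicator {0..} (i - j) * F i j + indicator {0<..} (j - i) * F i j" for i j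
    by (cases "j \<le> i") (auto simp: indicator_def)
  have "(\<integral>\<^sup>+i. \<integral>\<^sup>+j. \<integral>\<^sup>+w. F (w + max 0 (i - j)) (w + max 0 (j - i)) \<partial>expM 1 \<partial>expM b \<partial>expM a)
     = (\<integral>\<^sup>+i. \<integral>\<^sup>+j. \<integral>\<^sup>+w. indicator {0..} (i - j) * F (w + (i - j)) w \<partial>expM 1 \<partial>expM b \<partial>expM a)
     + (\<integral>\<^sup>+i. \<integral>\<^sup>+j. \<integral>\<^sup>+w. indicator {0<..} (j - i) * F w (w + (j - i)) \<partial>expM 1 \<partial>expM b \<partial>expM a)"
    unfolding split by (simp add: nn_integral_add)
  also have "(\<integral>\<^sup>+i. \<integral>\<^sup>+j. \<integral>\<^sup>+w. indicator {0<..} (j - i) * F w (w + (j - i)) \<partial>expM 1 \<partial>expM b \<partial>expM a)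
     = (\<integral>\<^sup>+j. \<integral>\<^sup>+i. \<integral>\<^sup>+w. indicator {0<..} (j - i) * F w (w + (j - i)) \<partial>expM 1 \<partial>expM a \<partial>expM b)"
    by (rule swap) measurable
  \<comment> \<open>The mirror image of the first half: the rates \<open>a\<close>, \<open>b\<close>
    and the arguments of \<open>F\<close> change places.\<close>
  also have "\<dots> = (\<integral>\<^sup>+j. \<integral>\<^sup>+i. indicator {0<..} (j - i) * F i j \<partial>expM a \<partial>expM b)"
    using ab by (intro burke_half[where F = "\<lambda>x y. F y x"]) auto
  also have "\<dots> = (\<integral>\<^sup>+i. \<integral>\<^sup>+j. indicator {0<..} (j - i) * F i j \<partial>expM b \<partial>expM a)"
    by (rule swap[symmetric]) measurable
  also have "(\<integral>\<^sup>+i. \<integral>\<^sup>+j. \<integral>\<^sup>+w. indicator {0..} (i - j) * F (w + (i - j)) w \<partial>expM 1 \<partial>expM b \<partial>expM a)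
     = (\<integral>\<^sup>+i. \<integral>\<^sup>+j. indicator {0..} (i - j) * F i j \<partial>expM b \<partial>expM a)"
    using ab F by (intro burke_half) auto
  also have "(\<integral>\<^sup>+i. \<integral>\<^sup>+j. indicator {0..} (i - j) * F i j \<partial>expM b \<partial>expM a)
     + (\<integral>\<^sup>+i. \<integral>\<^sup>+j. indicator {0<..} (j - i) * F i j \<partial>expM b \<partial>expM a) = (\<integral>\<^sup>+i. \<integral>\<^sup>+j. F i j \<partial>expM b \<partial>expM a)"
    by (subst (3) split') (simp add: nn_integral_add)
  finally show ?thesis .
qed

subsection \<open>Evolution of last passage profiles\<close>

abbreviation seqM :: "(nat \<Rightarrow> real) measure" where
  "seqM \<equiv> PiM UNIV (\<lambda>_. borel)"

abbreviation iid :: "real measure \<Rightarrow> (nat \<Rightarrow> real) measure" where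
  "iid \<mu> \<equiv> PiM UNIV (\<lambda>_. \<mu>)"

lemma sets_iid: "sets \<mu> = sets borel \<Longrightarrow> sets (iid \<mu>) = sets seqM"
  by (rule sets_PiM_cong) auto

lemma prob_space_iid: "prob_space \<mu> \<Longrightarrow> prob_space (iid \<mu>)"
  by (rule prob_space_PiM)

lemma measurable_seqI:
  assumes "\<And>k. (\<lambda>x. f x k) \<in> borel_measurable N"
  shows "f \<in> measurable N seqM"
  using assms by (intro measurable_PiM_single') auto

lemma measurable_seqD:
  assumes "f \<in> measurable N seqM"
  shows "(\<lambda>x. f x k) \<in> borel_measurable N"
  using measurable_compose[OF assms measurable_component_singleton[of k UNIV "\<lambda>_. borel"]] by simp

text \<open>Head and tail of an i.i.d. sequence are independent and the tail has the law of the
  whole; this drives the inductions along a profile.\<close>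

lemma nn_integral_iid:
  assumes mu: "prob_space \<mu>" "sets \<mu> = sets borel" and f: "f \<in> borel_measurable seqM"
  shows "(\<integral>\<^sup>+x. f x \<partial>iid \<mu>) = (\<integral>\<^sup>+x. \<integral>\<^sup>+X. f (case_nat x X) \<partial>iid \<mu> \<partial>\<mu>)"
proof -
  interpret prob_space \<mu> by fact
  interpret sequence_space \<mu> by unfold_locales
  note [measurable_cong] = mu(2)
  have f': "f \<in> borel_measurable (iid \<mu>)"
    using f sets_iid[OF mu(2)] by (simp cong: measurable_cong_sets)
  have "(\<integral>\<^sup>+x. f x \<partial>iid \<mu>) = (\<integral>\<^sup>+x. f x \<partial>distr (\<mu> \<Otimes>\<^sub>M iid \<mu>) (iid \<mu>) (\<lambda>(s, \<omega>). case_nat s \<omega>))"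
    by (simp add: PiM_iter)
  also have "\<dots> = (\<integral>\<^sup>+p. f (case p of (s, \<omega>) \<Rightarrow> case_nat s \<omega>) \<partial>(\<mu> \<Otimes>\<^sub>M iid \<mu>))"
    using f' by (intro nn_integral_distr) auto
  also have "\<dots> = (\<integral>\<^sup>+x. \<integral>\<^sup>+X. f (case_nat x X) \<partial>iid \<mu> \<partial>\<mu>)"
    using f' by (subst nn_integral_fst[symmetric]) auto
  finally show ?thesis .
qed

text \<open>One antidiagonal level of the recursion. A site looks only at its own index and the next
  one in the row below, so one-sided sequences suffice.\<close>

definition step :: "(nat \<Rightarrow> real) \<Rightarrow> (nat \<Rightarrow> real) \<Rightarrow> nat \<Rightarrow> real" where
  "step w g k = w k + max (g k) (g (Suc k))"

text \<open>The transition operator of the Markov chain of profiles, acting on functionals of the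
  profile.\<close>

definition stepE :: "((nat \<Rightarrow> real) \<Rightarrow> ennreal) \<Rightarrow> (nat \<Rightarrow> real) \<Rightarrow> ennreal" where
  "stepE f g = (\<integral>\<^sup>+w. f (step w g) \<partial>iid (expM 1))"

definition walk :: "(nat \<Rightarrow> real) \<Rightarrow> nat \<Rightarrow> real" where
  "walk d k = (\<Sum>i<k. d i)"

definition incM :: "real \<Rightarrow> real \<Rightarrow> real measure" where
  "incM a b = distr (expM a \<Otimes>\<^sub>M expM b) borel (\<lambda>(i, j). i - j)"

text \<open>The number \<open>m\<close> of visible sites is the induction variable of
  \<open>burke_step\<close>; for \<open>m = 0\<close> the functional is constant.\<close>

definition depends_on_first :: "nat \<Rightarrow> ((nat \<Rightarrow> real) \<Rightarrow> ennreal) \<Rightarrow> bool" where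
  "depends_on_first m f \<longleftrightarrow> (\<forall>g g'. (\<forall>i<m. g i = g' i) \<longrightarrow> f g = f g')"

lemma walk_0 [simp]: "walk d 0 = 0"
  by (simp add: walk_def)

lemma walk_case_nat: "walk (case_nat x d) = case_nat 0 (\<lambda>k. x + walk d k)"
proof
  fix k show "walk (case_nat x d) k = case_nat 0 (\<lambda>k. x + walk d k) k"
    by (cases k) (simp_all add: walk_def sum.lessThan_Suc_shift del: sum.lessThan_Suc)
qed

lemma step_case_nat: "step (case_nat w w') (case_nat c h) = case_nat (w + max c (h 0)) (step w' h)"
  by (auto simp: step_def fun_eq_iff split: nat.split)

lemma measurable_step [measurable (raw)]:
  assumes "w \<in> measurable N seqM" "g \<in> measurable N seqM"
  shows "(\<lambda>x. step (w x) (g x)) \<in> measurable N seqM"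
  unfolding step_def using assms[THEN measurable_seqD] by (intro measurable_seqI) simp

lemma measurable_walk [measurable (raw)]:
  assumes "d \<in> measurable N seqM"
  shows "(\<lambda>x. walk (d x)) \<in> measurable N seqM"
  unfolding walk_def using assms[THEN measurable_seqD] by (intro measurable_seqI) simp

lemma measurable_seq_add [measurable (raw)]:
  assumes "c \<in> borel_measurable N" "g \<in> measurable N seqM"
  shows "(\<lambda>x k. c x + g x k) \<in> measurable N seqM"
  using assms(1) assms(2)[THEN measurable_seqD] by (intro measurable_seqI) simp

lemma sets_iid_expM [simp, measurable_cong]: "sets (iid (expM l)) = sets seqM"
  by (rule sets_iid) simp

lemma sets_incM [simp, measurable_cong]: "sets (incM a b) = sets borel"
  by (simp add: incM_def)

lemma sets_iid_incM [simp, measurable_cong]: "sets (iid (incM a b)) = sets seqM"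
  by (rule sets_iid) simp

lemma prob_space_incM:
  assumes "0 < a" "0 < b"
  shows "prob_space (incM a b)"
proof -
  interpret A: prob_space "expM a" using assms by (intro prob_space_expM)
  interpret B: prob_space "expM b" using assms by (intro prob_space_expM)
  interpret pair_prob_space "expM a" "expM b" ..
  show ?thesis unfolding incM_def by (rule prob_space_distr) simp
qed

lemma nn_integral_incM:
  assumes ab: "0 < a" "0 < b" and [measurable]: "f \<in> borel_measurable borel"
  shows "(\<integral>\<^sup>+x. f x \<partial>incM a b) = (\<integral>\<^sup>+i. \<integral>\<^sup>+j. f (i - j) \<partial>expM b \<partial>expM a)"
proof -
  interpret B: prob_space "expM b" using ab by (intro prob_space_expM)
  have "(\<integral>\<^sup>+x. f x \<partial>incM a b) = (\<integral>\<^sup>+p. f (case p of (i, j) \<Rightarrow> i - j) \<partial>(expM a \<Otimes>\<^sub>M expM b))"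
    unfolding incM_def by (intro nn_integral_distr) auto
  also have "\<dots> = (\<integral>\<^sup>+i. \<integral>\<^sup>+j. f (i - j) \<partial>expM b \<partial>expM a)"
    by (subst B.nn_integral_fst[symmetric]) auto
  finally show ?thesis .
qed

lemma measurable_stepE [measurable]:
  assumes [measurable]: "f \<in> borel_measurable seqM"
  shows "stepE f \<in> borel_measurable seqM"
proof -
  interpret W: prob_space "iid (expM 1)" by (intro prob_space_iid prob_space_expM) simp
  show ?thesis unfolding stepE_def[abs_def] by measurable
qed

lemma stepE_case_nat:
  assumes [measurable]: "f \<in> borel_measurable seqM"
  shows "stepE f (case_nat c h) = (\<integral>\<^sup>+w. stepE (\<lambda>g. f (case_nat (w + max c (h 0)) g)) h \<partial>expM 1)"
proof -
  have h: "(\<lambda>_. h) \<in> measurable N seqM" for N :: "'z measure" by (intro measurable_seqI) simp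
  have [measurable]: "(\<lambda>w. step w (case_nat c h)) \<in> measurable seqM seqM"
    by (rule measurable_step) (use h in measurable)
  show ?thesis
    unfolding stepE_def
    by (subst nn_integral_iid) (auto simp: prob_space_expM step_case_nat)
qed

lemma depends_on_first_stepE:
  "depends_on_first m f \<Longrightarrow> depends_on_first (Suc m) (stepE f)"
  unfolding depends_on_first_def stepE_def
  by (intro allI impI arg_cong2[where f=nn_integral] refl ext) (auto simp: step_def)

text \<open>Induction on the number of visible sites. \<open>burke_local\<close> treats the first
  site, the induction hypothesis the sites to its right. The latter produces an Exp(a) shift
  \<open>A\<close>, which combines with the Exp(b) variable left by \<open>burke_local\<close> into
  a new first increment.\<close>

lemma burke_step:
  assumes ab: "0 < a" "0 < b" "a + b = 1"
    and "f \<in> borel_measurable seqM" "depends_on_first m f"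
  shows "(\<integral>\<^sup>+d. stepE f (\<lambda>k. c + walk d k) \<partial>iid (incM a b))
       = (\<integral>\<^sup>+A. \<integral>\<^sup>+d. f (\<lambda>k. c + A + walk d k) \<partial>iid (incM a b) \<partial>expM a)"
  using assms(4,5)
proof (induction m arbitrary: f c)
  case 0
  interpret A: prob_space "expM a" using ab by (intro prob_space_expM)
  interpret W: prob_space "iid (expM 1)" by (intro prob_space_iid prob_space_expM) simp
  interpret V: prob_space "iid (incM a b)" using ab by (intro prob_space_iid prob_space_incM)
  have "f g = f (\<lambda>_. 0)" for g using 0 by (simp add: depends_on_first_def)
  then have "f = (\<lambda>_. f (\<lambda>_. 0))" by blast
  then obtain r where "f = (\<lambda>_. r)" by blast
  then show ?case
    by (simp add: stepE_def W.emeasure_space_1 V.emeasure_space_1 A.emeasure_space_1[simplified])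
next
  case (Suc m)
  note [measurable] = Suc.prems(1)
  interpret A: prob_space "expM a" using ab by (intro prob_space_expM)
  interpret B: prob_space "expM b" using ab by (intro prob_space_expM)
  interpret E: prob_space "expM 1" by (intro prob_space_expM) simp
  interpret W: prob_space "iid (expM 1)" by (intro prob_space_iid prob_space_expM) simp
  interpret V: prob_space "iid (incM a b)" using ab by (intro prob_space_iid prob_space_incM)
  interpret D: prob_space "incM a b" using ab by (intro prob_space_incM)
  have sep: "(\<lambda>k. c + walk (case_nat x d) k) = case_nat c (\<lambda>k. c + x + walk d k)" for c x d
    by (auto simp: walk_case_nat fun_eq_iff add.assoc split: nat.split)
  \<comment> \<open>\<open>p\<close> is the new height of the first site above \<open>c\<close>.
    Since \<open>p - q\<close> equals the old first increment \<open>i - j\<close>, the pair also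
    determines where the tail starts, so \<open>burke_local\<close> acts on both at once.\<close>
  define \<Phi> where "\<Phi> p q = (\<integral>\<^sup>+A. \<integral>\<^sup>+d. f (case_nat (c + p) (\<lambda>k. c + (p - q) + A + walk d k)) \<partial>iid (incM a b) \<partial>expM a)" for p q
  have \<Phi>: "(\<lambda>(p, q). \<Phi> p q) \<in> borel_measurable (borel \<Otimes>\<^sub>M borel)"
    unfolding \<Phi>_def by measurable
  have "(\<integral>\<^sup>+d. stepE f (\<lambda>k. c + walk d k) \<partial>iid (incM a b))
      = (\<integral>\<^sup>+x. \<integral>\<^sup>+d. stepE f (case_nat c (\<lambda>k. c + x + walk d k)) \<partial>iid (incM a b) \<partial>incM a b)"
    using ab by (subst nn_integral_iid) (auto simp: sep prob_space_incM)
  also have "\<dots> = (\<integral>\<^sup>+x. \<integral>\<^sup>+d. \<integral>\<^sup>+w. stepE (\<lambda>g. f (case_nat (w + max c (c + x)) g)) (\<lambda>k. c + x + walk d k) \<partial>expM 1 \<partial>iid (incM a b) \<partial>incM a b)"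
    by (simp add: stepE_case_nat)
  \<comment> \<open>The first weight moves outside: for fixed \<open>x\<close> and \<open>w\<close>
    the rest is a functional of the tail alone, with base height \<open>c + x\<close>.\<close>
  also have "\<dots> = (\<integral>\<^sup>+x. \<integral>\<^sup>+w. \<integral>\<^sup>+d. stepE (\<lambda>g. f (case_nat (w + max c (c + x)) g)) (\<lambda>k. c + x + walk d k) \<partial>iid (incM a b) \<partial>expM 1 \<partial>incM a b)"
  proof (intro nn_integral_cong nn_integral_swap V.sigma_finite_measure_axioms E.sigma_finite_measure_axioms)
    fix x
    show "(\<lambda>(d, w). stepE (\<lambda>g. f (case_nat (w + max c (c + x)) g)) (\<lambda>k. c + x + walk d k))
        \<in> borel_measurable (iid (incM a b) \<Otimes>\<^sub>M expM 1)"
      unfolding stepE_def by measurable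
  qed
  also have "\<dots> = (\<integral>\<^sup>+x. \<integral>\<^sup>+w. \<integral>\<^sup>+A. \<integral>\<^sup>+d. f (case_nat (w + max c (c + x)) (\<lambda>k. c + x + A + walk d k)) \<partial>iid (incM a b) \<partial>expM a \<partial>expM 1 \<partial>incM a b)"
  proof (intro nn_integral_cong Suc.IH)
    fix x w
    show "(\<lambda>g. f (case_nat (w + max c (c + x)) g)) \<in> borel_measurable seqM" by measurable
    show "depends_on_first m (\<lambda>g. f (case_nat (w + max c (c + x)) g))"
      using Suc.prems(2) unfolding depends_on_first_def
      by (auto intro!: Suc.prems(2)[unfolded depends_on_first_def, rule_format] split: nat.split)
  qed
  also have "\<dots> = (\<integral>\<^sup>+i. \<integral>\<^sup>+j. \<integral>\<^sup>+w. \<Phi> (w + max 0 (i - j)) (w + max 0 (j - i)) \<partial>expM 1 \<partial>expM b \<partial>expM a)"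
  proof -
    have *: "w + max 0 (i - j) - (w + max 0 (j - i)) = i - j"
      "c + (w + max 0 (i - j)) = w + max c (c + (i - j))" for i j w :: real by auto
    show ?thesis
      unfolding \<Phi>_def * using ab by (subst nn_integral_incM) auto
  qed
  also have "\<dots> = (\<integral>\<^sup>+i. \<integral>\<^sup>+j. \<Phi> i j \<partial>expM b \<partial>expM a)"
    by (rule burke_local[OF ab \<Phi>])
  \<comment> \<open>Regrouping \<open>c + (i - j) + A\<close> as \<open>c + i + (A - j)\<close>:
    \<open>A - j\<close> is a fresh increment with law \<open>incM a b\<close>, and \<open>i\<close>
    becomes the Exp(a) shift of the whole profile.\<close>
  also have "\<dots> = (\<integral>\<^sup>+i. \<integral>\<^sup>+A. \<integral>\<^sup>+j. \<integral>\<^sup>+d. f (case_nat (c + i) (\<lambda>k. c + (i - j) + A + walk d k)) \<partial>iid (incM a b) \<partial>expM b \<partial>expM a \<partial>expM a)"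
    unfolding \<Phi>_def
  proof (intro nn_integral_cong nn_integral_swap A.sigma_finite_measure_axioms B.sigma_finite_measure_axioms)
    fix i
    show "(\<lambda>(j, A). \<integral>\<^sup>+d. f (case_nat (c + i) (\<lambda>k. c + (i - j) + A + walk d k)) \<partial>iid (incM a b))
        \<in> borel_measurable (expM b \<Otimes>\<^sub>M expM a)"
      by measurable
  qed
  also have "\<dots> = (\<integral>\<^sup>+i. \<integral>\<^sup>+x. \<integral>\<^sup>+d. f (case_nat (c + i) (\<lambda>k. c + i + x + walk d k)) \<partial>iid (incM a b) \<partial>incM a b \<partial>expM a)"
    using ab by (subst nn_integral_incM) (auto simp: algebra_simps)
  also have "\<dots> = (\<integral>\<^sup>+i. \<integral>\<^sup>+d. f (\<lambda>k. c + i + walk d k) \<partial>iid (incM a b) \<partial>expM a)"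
  proof (rule nn_integral_cong)
    fix i
    show "(\<integral>\<^sup>+x. \<integral>\<^sup>+d. f (case_nat (c + i) (\<lambda>k. c + i + x + walk d k)) \<partial>iid (incM a b) \<partial>incM a b)
        = (\<integral>\<^sup>+d. f (\<lambda>k. c + i + walk d k) \<partial>iid (incM a b))"
      using ab by (subst nn_integral_iid[OF prob_space_incM]) (auto simp: sep)
  qed
  finally show ?case .
qed

subsection \<open>Exponential moments from the stationary initial profile\<close>

text \<open>Covariance under vertical shifts, which lets the random shift of
  \<open>burke_step\<close> factor out of the expectation.\<close>

definition homogeneous :: "real \<Rightarrow> ((nat \<Rightarrow> real) \<Rightarrow> ennreal) \<Rightarrow> bool" where
  "homogeneous s f \<longleftrightarrow> (\<forall>c g. f (\<lambda>k. c + g k) = ennreal (exp (s * c)) * f g)"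

lemma measurable_walk_nth [measurable (raw)]:
  "d \<in> measurable N seqM \<Longrightarrow> (\<lambda>x. walk (d x) k) \<in> borel_measurable N"
  by (rule measurable_seqD[OF measurable_walk])

lemma measurable_step_left: "(\<lambda>w. step w g) \<in> measurable seqM seqM"
proof -
  have "(\<lambda>_. g) \<in> measurable seqM seqM" by (intro measurable_seqI) simp
  then show ?thesis by (intro measurable_step) auto
qed

lemma homogeneous_stepE:
  assumes [measurable]: "f \<in> borel_measurable seqM" and "homogeneous s f"
  shows "homogeneous s (stepE f)"
proof -
  note [measurable] = measurable_step_left
  have "step w (\<lambda>k. c + g k) = (\<lambda>k. c + step w g k)" for w c g
    by (auto simp: step_def fun_eq_iff max_def)
  with assms(2) show ?thesis
    by (simp add: homogeneous_def stepE_def nn_integral_cmult)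
qed

text \<open>The Exp(a) shift from \<open>burke_step\<close> contributes its exponential moment at
  \<open>a - b\<close>, namely \<open>a / (a - (a - b)) = a / b\<close>.\<close>

lemma stationary_step:
  assumes ab: "0 < a" "0 < b" "a + b = 1"
    and f[measurable]: "f \<in> borel_measurable seqM" and m: "depends_on_first m f" and h: "homogeneous (a - b) f"
  shows "(\<integral>\<^sup>+d. stepE f (walk d) \<partial>iid (incM a b)) = ennreal (a / b) * (\<integral>\<^sup>+d. f (walk d) \<partial>iid (incM a b))"
proof -
  have "(\<integral>\<^sup>+d. stepE f (walk d) \<partial>iid (incM a b))
      = (\<integral>\<^sup>+A. \<integral>\<^sup>+d. f (\<lambda>k. A + walk d k) \<partial>iid (incM a b) \<partial>expM a)"
    using burke_step[OF ab f m, of 0] by simp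
  also have "\<dots> = (\<integral>\<^sup>+A. ennreal (exp ((a - b) * A)) * (\<integral>\<^sup>+d. f (walk d) \<partial>iid (incM a b)) \<partial>expM a)"
    using h by (simp add: homogeneous_def nn_integral_cmult)
  also have "\<dots> = ennreal (a / b) * (\<integral>\<^sup>+d. f (walk d) \<partial>iid (incM a b))"
    using ab nn_integral_exp_expM[of a "a - b"] by (simp add: nn_integral_multc)
  finally show ?thesis .
qed

lemma iterate_stepE:
  assumes "f \<in> borel_measurable seqM" "depends_on_first m f" "homogeneous s f"
  shows "(stepE ^^ n) f \<in> borel_measurable seqM" "depends_on_first (n + m) ((stepE ^^ n) f)"
    "homogeneous s ((stepE ^^ n) f)"
  by (induction n) (use assms in \<open>auto intro: measurable_stepE depends_on_first_stepE homogeneous_stepE\<close>)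

lemma stationary_iterate:
  assumes ab: "0 < a" "0 < b" "a + b = 1"
    and f: "f \<in> borel_measurable seqM" "depends_on_first m f" "homogeneous (a - b) f"
  shows "(\<integral>\<^sup>+d. (stepE ^^ n) f (walk d) \<partial>iid (incM a b)) = ennreal ((a / b) ^ n) * (\<integral>\<^sup>+d. f (walk d) \<partial>iid (incM a b))"
proof (induction n)
  case (Suc n)
  have "ennreal ((a / b) ^ Suc n) = ennreal (a / b) * ennreal ((a / b) ^ n)"
    unfolding power_Suc using ab by (intro ennreal_mult) auto
  then show ?case
    using stationary_step[OF ab iterate_stepE[OF f]] Suc by (simp only: funpow.simps o_apply mult.assoc)
qed simp

text \<open>The re-indexing is what makes this class of functionals stable under \<^const>\<open>stepE\<close>: after
  one step, the perturbation at position \<open>k\<close> comes from whichever of \<open>k\<close>, \<open>Suc k\<close> attains the maximum.\<close>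

definition walk_dominated :: "real \<Rightarrow> real \<Rightarrow> ((nat \<Rightarrow> real) \<Rightarrow> ennreal) \<Rightarrow> bool" where
  "walk_dominated a b f \<longleftrightarrow> mono f \<and>
     (\<forall>g \<sigma>. f g \<le> (\<integral>\<^sup>+d. f (\<lambda>k. g k + walk d (\<sigma> k)) \<partial>iid (incM a b)))"

text \<open>For fixed weights, the maximum of the perturbed heights is at least the perturbed height
  at the site where the unperturbed \<open>g\<close> is larger. That site does not depend on
  \<open>d\<close>, so the domination for \<open>f\<close> applies to \<open>step w g\<close> with
  the composed index map; the weights are integrated last.\<close>

lemma walk_dominated_stepE:
  assumes ab: "0 < a" "0 < b" and f[measurable]: "f \<in> borel_measurable seqM" and d: "walk_dominated a b f"
  shows "walk_dominated a b (stepE f)"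
proof -
  interpret W: prob_space "iid (expM 1)" by (intro prob_space_iid prob_space_expM) simp
  interpret V: prob_space "iid (incM a b)" using ab by (intro prob_space_iid prob_space_incM)
  have mono: "mono f" and dom: "f g \<le> (\<integral>\<^sup>+d. f (\<lambda>k. g k + walk d (\<sigma> k)) \<partial>iid (incM a b))" for g \<sigma>
    using d by (auto simp: walk_dominated_def)
  have "mono (stepE f)"
  proof (rule monoI)
    fix g h :: "nat \<Rightarrow> real" assume "g \<le> h"
    have "step w g \<le> step w h" for w
      unfolding le_fun_def step_def
      by (intro allI add_left_mono max.mono) (use \<open>g \<le> h\<close> in \<open>auto simp: le_fun_def\<close>)
    then show "stepE f g \<le> stepE f h"
      unfolding stepE_def by (intro nn_integral_mono monoD[OF mono])
  qed
  moreover have "stepE f g \<le> (\<integral>\<^sup>+d. stepE f (\<lambda>k. g k + walk d (\<sigma> k)) \<partial>iid (incM a b))" for g \<sigma>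
  proof -
    define \<tau> where "\<tau> k = (if g (Suc k) \<le> g k then k else Suc k)" for k
    have le: "(\<lambda>k. step w g k + walk d (\<sigma> (\<tau> k))) \<le> step w (\<lambda>k. g k + walk d (\<sigma> k))" for w d
      by (auto simp: le_fun_def step_def \<tau>_def max_def)
    have "stepE f g \<le> (\<integral>\<^sup>+w. \<integral>\<^sup>+d. f (\<lambda>k. step w g k + walk d (\<sigma> (\<tau> k))) \<partial>iid (incM a b) \<partial>iid (expM 1))"
      unfolding stepE_def by (intro nn_integral_mono dom)
    also have "\<dots> \<le> (\<integral>\<^sup>+w. \<integral>\<^sup>+d. f (step w (\<lambda>k. g k + walk d (\<sigma> k))) \<partial>iid (incM a b) \<partial>iid (expM 1))"
      by (intro nn_integral_mono monoD[OF mono] le)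
    also have "\<dots> = (\<integral>\<^sup>+d. stepE f (\<lambda>k. g k + walk d (\<sigma> k)) \<partial>iid (incM a b))"
      unfolding stepE_def
    proof (rule nn_integral_swap[OF W.sigma_finite_measure_axioms V.sigma_finite_measure_axioms])
      have [measurable]: "(\<lambda>p k. g k + walk (snd p) (\<sigma> k)) \<in> measurable (iid (expM 1) \<Otimes>\<^sub>M iid (incM a b)) seqM"
        by (intro measurable_seqI) measurable
      show "(\<lambda>(w, d). f (step w (\<lambda>k. g k + walk d (\<sigma> k)))) \<in> borel_measurable (iid (expM 1) \<Otimes>\<^sub>M iid (incM a b))"
        unfolding split_beta' by measurable
    qed
    finally show ?thesis .
  qed
  ultimately show ?thesis by (simp add: walk_dominated_def)
qed

section \<open>Exponential moments of the increments and of the walk\<close>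

lemma nn_integral_exp_incM:
  assumes "0 < a" "0 < b" "s < a" "- b < s"
  shows "(\<integral>\<^sup>+x. ennreal (exp (s * x)) \<partial>incM a b) = ennreal (a / (a - s) * (b / (b + s)))"
proof -
  have "(\<integral>\<^sup>+x. ennreal (exp (s * x)) \<partial>incM a b)
      = (\<integral>\<^sup>+i. \<integral>\<^sup>+j. ennreal (exp (s * i)) * ennreal (exp (- s * j)) \<partial>expM b \<partial>expM a)"
    using assms by (subst nn_integral_incM) (auto simp: ennreal_mult[symmetric] exp_add[symmetric] algebra_simps)
  also have "\<dots> = ennreal (a / (a - s)) * ennreal (b / (b + s))"
    using assms nn_integral_exp_expM[of a s] nn_integral_exp_expM[of b "- s"]
    by (simp add: nn_integral_cmult nn_integral_multc)
  finally show ?thesis using assms by (simp add: ennreal_mult[symmetric])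
qed

lemma walk_case_nat_Suc: "walk (case_nat x d) (Suc k) = x + walk d k"
  by (simp add: walk_case_nat)

lemma nn_integral_exp_walk:
  assumes ab: "0 < a" "0 < b"
    and "(\<integral>\<^sup>+x. ennreal (exp (s * x)) \<partial>incM a b) = 1"
  shows "(\<integral>\<^sup>+d. ennreal (exp (s * walk d k)) \<partial>iid (incM a b)) = 1"
proof (induction k)
  case 0
  interpret V: prob_space "iid (incM a b)" using ab by (intro prob_space_iid prob_space_incM)
  show ?case by (simp add: V.emeasure_space_1)
next
  case (Suc k)
  have "(\<integral>\<^sup>+d. ennreal (exp (s * walk d (Suc k))) \<partial>iid (incM a b))
     = (\<integral>\<^sup>+x. \<integral>\<^sup>+d. ennreal (exp (s * x)) * ennreal (exp (s * walk d k)) \<partial>iid (incM a b) \<partial>incM a b)"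
    using ab by (subst nn_integral_iid)
      (auto simp: prob_space_incM walk_case_nat_Suc ennreal_mult[symmetric] exp_add[symmetric] algebra_simps)
  also have "\<dots> = 1" using Suc assms(3) by (simp add: nn_integral_cmult)
  finally show ?case .
qed

section \<open>The exponential of the maximum over a window as a functional of the profile\<close>

definition expmax :: "real \<Rightarrow> nat \<Rightarrow> (nat \<Rightarrow> real) \<Rightarrow> ennreal" where
  "expmax s m g = Max ((\<lambda>j. ennreal (exp (s * g j))) ` {..m})"

lemma expmax_ge: "j \<le> m \<Longrightarrow> ennreal (exp (s * g j)) \<le> expmax s m g"
  unfolding expmax_def by (intro Max_ge) auto

lemma expmax_attained: "\<exists>j\<le>m. expmax s m g = ennreal (exp (s * g j))"
proof -
  have "expmax s m g \<in> (\<lambda>j. ennreal (exp (s * g j))) ` {..m}"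
    unfolding expmax_def by (intro Max_in) auto
  then show ?thesis by auto
qed

lemma expmax_0 [simp]: "expmax s 0 g = ennreal (exp (s * g 0))"
  by (simp add: expmax_def)

lemma expmax_Suc: "expmax s (Suc m) g = max (ennreal (exp (s * g 0))) (expmax s m (\<lambda>k. g (Suc k)))"
  unfolding expmax_def atMost_Suc_eq_insert_0 by (simp add: image_image)

lemma measurable_expmax [measurable]: "expmax s m \<in> borel_measurable seqM"
  unfolding expmax_def[abs_def] by measurable

lemma depends_on_first_expmax: "depends_on_first (Suc m) (expmax s m)"
  unfolding depends_on_first_def expmax_def
  by (intro allI impI arg_cong[where f=Max] image_cong refl) (simp add: less_Suc_eq_le)

lemma homogeneous_expmax: "homogeneous s (expmax s m)"
  unfolding homogeneous_def
proof (intro allI antisym)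
  fix c :: real and g :: "nat \<Rightarrow> real"
  have *: "ennreal (exp (s * (c + g j))) = ennreal (exp (s * c)) * ennreal (exp (s * g j))" for j
    by (simp add: ennreal_mult[symmetric] exp_add[symmetric] algebra_simps)
  obtain j where "j \<le> m" "expmax s m (\<lambda>k. c + g k) = ennreal (exp (s * (c + g j)))"
    using expmax_attained[of m s "\<lambda>k. c + g k"] by blast
  then show "expmax s m (\<lambda>k. c + g k) \<le> ennreal (exp (s * c)) * expmax s m g"
    using expmax_ge[of j m s g] by (simp add: * mult_left_mono)
  obtain j where "j \<le> m" "expmax s m g = ennreal (exp (s * g j))"
    using expmax_attained[of m s g] by blast
  then show "ennreal (exp (s * c)) * expmax s m g \<le> expmax s m (\<lambda>k. c + g k)"
    using expmax_ge[of j m s "\<lambda>k. c + g k"] by (simp add: *)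
qed

text \<open>The maximizing site \<open>j\<close> of \<open>g\<close> is fixed before the walk is
  sampled. There the perturbation multiplies the value by a factor of mean 1, and the perturbed
  maximum is at least the perturbed value at \<open>j\<close>.\<close>

lemma walk_dominated_expmax:
  assumes ab: "0 < a" "0 < b" "b \<le> a"
  shows "walk_dominated a b (expmax (a - b) m)"
  unfolding walk_dominated_def
proof (intro conjI monoI allI)
  fix g h :: "nat \<Rightarrow> real" assume "g \<le> h"
  obtain j where j: "j \<le> m" "expmax (a - b) m g = ennreal (exp ((a - b) * g j))"
    using expmax_attained by blast
  have "ennreal (exp ((a - b) * g j)) \<le> ennreal (exp ((a - b) * h j))"
    using \<open>g \<le> h\<close> ab by (auto simp: le_fun_def intro!: ennreal_leI mult_left_mono)
  from order_trans[OF this expmax_ge[OF j(1), of "a - b" h]] j show "expmax (a - b) m g \<le> expmax (a - b) m h"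
    by simp
next
  fix g :: "nat \<Rightarrow> real" and \<sigma> :: "nat \<Rightarrow> nat"
  obtain j where j: "j \<le> m" "expmax (a - b) m g = ennreal (exp ((a - b) * g j))"
    using expmax_attained by blast
  have "(\<integral>\<^sup>+x. ennreal (exp ((a - b) * x)) \<partial>incM a b) = 1"
    using ab by (subst nn_integral_exp_incM) auto
  from nn_integral_exp_walk[OF ab(1,2) this, of "\<sigma> j"]
  have "expmax (a - b) m g = (\<integral>\<^sup>+d. ennreal (exp ((a - b) * (g j + walk d (\<sigma> j)))) \<partial>iid (incM a b))"
    by (simp add: j distrib_left exp_add ennreal_mult nn_integral_cmult)
  also have "\<dots> \<le> (\<integral>\<^sup>+d. expmax (a - b) m (\<lambda>k. g k + walk d (\<sigma> k)) \<partial>iid (incM a b))"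
    by (intro nn_integral_mono expmax_ge[OF j(1), of _ "\<lambda>k. g k + walk _ (\<sigma> k)"])
  finally show "expmax (a - b) m g \<le> (\<integral>\<^sup>+d. expmax (a - b) m (\<lambda>k. g k + walk d (\<sigma> k)) \<partial>iid (incM a b))" .
qed

text \<open>A Doob-type bound: \<open>\<E>[max x Z] \<le> x + B\<^sup>m / x\<close> integrates the maximal inequality
  \<open>\<P>(Z \<ge> y) \<le> B\<^sup>m / y\<^sup>2\<close>, and it is stable under conditioning on the first increment.\<close>

lemma nn_integral_max_expmax_walk:
  assumes ab: "0 < a" "0 < b" and B: "1 \<le> B" "(\<integral>\<^sup>+x. ennreal (exp (2 * s * x)) \<partial>incM a b) = ennreal B"
    and "0 < x"
  shows "(\<integral>\<^sup>+d. max (ennreal x) (expmax s m (walk d)) \<partial>iid (incM a b)) \<le> ennreal (x + B ^ m / x)"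
  using \<open>0 < x\<close>
proof (induction m arbitrary: x)
  case 0
  interpret V: prob_space "iid (incM a b)" using ab by (intro prob_space_iid prob_space_incM)
  have "max x 1 \<le> x + 1 / x"
  proof (cases "1 \<le> x")
    case False
    then have "1 \<le> 1 / x" "0 < x" using 0 by simp_all
    then have "1 \<le> x + 1 / x" by linarith
    then show ?thesis using False by simp
  qed (use 0 in simp)
  moreover have "max (ennreal x) 1 = ennreal (max x 1)" using 0 by (simp add: max_def)
  ultimately show ?case by (simp add: V.emeasure_space_1 ennreal_leI del: ennreal_plus)
next
  case (Suc m)
  interpret V: prob_space "iid (incM a b)" using ab by (intro prob_space_iid prob_space_incM)
  interpret D: prob_space "incM a b" using ab by (intro prob_space_incM)
  \<comment> \<open>The walk starts at 0, so the first site contributes the value 1; it is absorbed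
    into the threshold.\<close>
  define x' where "x' = max x 1"
  have x': "0 < x'" "1 \<le> x'" by (auto simp: x'_def)
  \<comment> \<open>Given the first increment \<open>y\<close>, the remaining walk faces the
    threshold \<open>x'\<close> rescaled by \<open>exp (s * y)\<close>.\<close>
  have split: "max (ennreal x) (expmax s (Suc m) (walk (case_nat y d)))
      = ennreal (exp (s * y)) * max (ennreal (x' / exp (s * y))) (expmax s m (walk d))" for y d
  proof -
    have "expmax s (Suc m) (walk (case_nat y d)) = max 1 (ennreal (exp (s * y)) * expmax s m (walk d))"
      using homogeneous_expmax[of s m] by (simp add: expmax_Suc walk_case_nat homogeneous_def)
    moreover have "max (ennreal x) 1 = ennreal x'"
      using Suc.prems by (simp add: x'_def max_def)
    ultimately have "max (ennreal x) (expmax s (Suc m) (walk (case_nat y d)))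
        = max (ennreal x') (ennreal (exp (s * y)) * expmax s m (walk d))"
      by (simp only: max.assoc[symmetric])
    moreover have "ennreal x' = ennreal (exp (s * y)) * ennreal (x' / exp (s * y))"
      using x' by (simp add: ennreal_mult[symmetric])
    moreover have "max (ennreal (exp (s * y)) * ennreal (x' / exp (s * y))) (ennreal (exp (s * y)) * expmax s m (walk d))
        = ennreal (exp (s * y)) * max (ennreal (x' / exp (s * y))) (expmax s m (walk d))"
      by (rule max_of_mono) (intro monoI mult_left_mono, auto)
    ultimately show ?thesis by simp
  qed
  have "(\<integral>\<^sup>+d. max (ennreal x) (expmax s (Suc m) (walk d)) \<partial>iid (incM a b))
      = (\<integral>\<^sup>+y. ennreal (exp (s * y)) * (\<integral>\<^sup>+d. max (ennreal (x' / exp (s * y))) (expmax s m (walk d)) \<partial>iid (incM a b)) \<partial>incM a b)"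
    using ab by (subst nn_integral_iid) (auto simp: prob_space_incM split nn_integral_cmult)
  also have "\<dots> \<le> (\<integral>\<^sup>+y. ennreal (exp (s * y)) * ennreal (x' / exp (s * y) + B ^ m / (x' / exp (s * y))) \<partial>incM a b)"
    using x' by (intro nn_integral_mono mult_left_mono Suc.IH) auto
  \<comment> \<open>The factor \<open>exp (s * y)\<close> cancels in the first summand and is
    squared in the second, where integration turns it into one more \<open>B\<close>.\<close>
  also have "\<dots> = (\<integral>\<^sup>+y. ennreal x' + ennreal (B ^ m / x') * ennreal (exp (2 * s * y)) \<partial>incM a b)"
  proof (rule nn_integral_cong)
    fix y
    define e where "e = exp (s * y)"
    have e: "0 < e" "exp (2 * s * y) = e * e" by (simp_all add: e_def exp_add[symmetric])
    have Bx: "0 \<le> B ^ m / x'" using x' B(1) by simp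
    have "ennreal e * ennreal (x' / e + B ^ m / (x' / e)) = ennreal (e * (x' / e + B ^ m / (x' / e)))"
      using e x' B(1) by (intro ennreal_mult[symmetric] add_nonneg_nonneg) auto
    moreover have "e * (x' / e + B ^ m / (x' / e)) = x' + B ^ m / x' * (e * e)"
      using e x' by (simp add: field_simps)
    moreover have "ennreal (x' + B ^ m / x' * (e * e)) = ennreal x' + ennreal (B ^ m / x') * ennreal (e * e)"
    proof -
      have ee: "0 \<le> e * e" using e(1) by simp
      show ?thesis
        unfolding ennreal_mult[OF Bx ee, symmetric]
        by (rule ennreal_plus) (use x'(1) mult_nonneg_nonneg[OF Bx ee] in linarith)+
    qed
    ultimately show "ennreal (exp (s * y)) * ennreal (x' / exp (s * y) + B ^ m / (x' / exp (s * y)))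
        = ennreal x' + ennreal (B ^ m / x') * ennreal (exp (2 * s * y))"
      unfolding e(2) e_def[symmetric] by (simp only:)
  qed
  also have "\<dots> = ennreal (x' + B ^ Suc m / x')"
  proof -
    have Bx: "0 \<le> B ^ m / x'" using x' B(1) by simp
    have "(\<integral>\<^sup>+y. ennreal x' + ennreal (B ^ m / x') * ennreal (exp (2 * s * y)) \<partial>incM a b)
        = ennreal x' + ennreal (B ^ m / x') * ennreal B"
      by (simp add: nn_integral_add nn_integral_cmult D.emeasure_space_1 B(2))
    moreover have "ennreal x' + ennreal (B ^ m / x') * ennreal B = ennreal (x' + B ^ m / x' * B)"
    proof -
      have B0: "0 \<le> B" using B(1) by simp
      show ?thesis
        unfolding ennreal_mult[OF Bx B0, symmetric]
        by (rule ennreal_plus[symmetric]) (use x'(1) mult_nonneg_nonneg[OF Bx B0] in linarith)+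
    qed
    moreover have "B ^ m / x' * B = B ^ Suc m / x'" by simp
    ultimately show ?thesis by (simp only:)
  qed
  also have "\<dots> \<le> ennreal (x + B ^ Suc m / x)"
  proof (rule ennreal_leI)
    define y where "y = B ^ Suc m"
    have "1 \<le> y" unfolding y_def using B(1) by (rule one_le_power)
    show "x' + B ^ Suc m / x' \<le> x + B ^ Suc m / x"
    proof (cases "1 \<le> x")
      case False
      \<comment> \<open>After multiplication by \<open>x\<close>, this is exactly
        \<open>1 + y \<le> x + y / x\<close>, the cost of lowering the threshold from 1 to
        \<open>x\<close>.\<close>
      then have "0 \<le> (1 - x) * (y - x)" using \<open>1 \<le> y\<close> by (intro mult_nonneg_nonneg) auto
      then have "x * (1 + y) \<le> x * x + y" by (simp add: algebra_simps)
      then have "1 + y \<le> x + y / x" using Suc.prems by (simp add: field_simps)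
      then show ?thesis using False by (simp add: x'_def y_def)
    qed (simp add: x'_def)
  qed
  finally show ?case .
qed

text \<open>The flat start is dominated by the walk start, stationarity extracts
  \<open>(a / b) ^ n\<close>, and the maximum of the walk is bounded with threshold 1. The condition
  \<open>a < 2 * b\<close> makes the moment at \<open>2 * (a - b)\<close> finite.\<close>

lemma iterate_stepE_expmax_le:
  assumes ab: "0 < a" "0 < b" "a + b = 1" "b \<le> a" "a < 2 * b"
  shows "(stepE ^^ n) (expmax (a - b) m) (\<lambda>_. 0)
    \<le> ennreal ((a / b) ^ n * (1 + (a * b / ((2 * b - a) * (2 * a - b))) ^ m))"
proof -
  define B where "B = a * b / ((2 * b - a) * (2 * a - b))"
  have B: "(\<integral>\<^sup>+x. ennreal (exp (2 * (a - b) * x)) \<partial>incM a b) = ennreal B"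
    using ab by (subst nn_integral_exp_incM) (auto simp: B_def field_simps)
  \<comment> \<open>The difference of the two sides is \<open>2 * (a - b)^2\<close>; this gives
    \<open>1 \<le> B\<close>.\<close>
  have "(2 * b - a) * (2 * a - b) \<le> a * b"
    using zero_le_square[of "a - b"] by (simp add: algebra_simps)
  moreover have "0 < (2 * b - a) * (2 * a - b)" using ab by (intro mult_pos_pos) auto
  ultimately have "1 \<le> B" by (simp add: B_def)
  note f = measurable_expmax[of "a - b" m] depends_on_first_expmax[of m "a - b"] homogeneous_expmax[of "a - b" m]
  have "walk_dominated a b ((stepE ^^ n) (expmax (a - b) m))"
  proof (induction n)
    case 0
    show ?case using walk_dominated_expmax[OF ab(1,2,4)] by simp
  next
    case (Suc n)
    show ?case using walk_dominated_stepE[OF ab(1,2) iterate_stepE(1)[OF f] Suc] by simp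
  qed
  then have "(stepE ^^ n) (expmax (a - b) m) (\<lambda>_. 0) \<le> (\<integral>\<^sup>+d. (stepE ^^ n) (expmax (a - b) m) (\<lambda>k. walk d k) \<partial>iid (incM a b))"
    unfolding walk_dominated_def
    by (drule_tac conjunct2, drule_tac x = "\<lambda>_. 0" in spec, drule_tac x = "\<lambda>k. k" in spec) simp
  also have "\<dots> = ennreal ((a / b) ^ n) * (\<integral>\<^sup>+d. expmax (a - b) m (walk d) \<partial>iid (incM a b))"
    using stationary_iterate[OF ab(1-3) f] by simp
  also have "\<dots> \<le> ennreal ((a / b) ^ n) * ennreal (1 + B ^ m / 1)"
  proof (rule mult_left_mono)
    have "(\<integral>\<^sup>+d. expmax (a - b) m (walk d) \<partial>iid (incM a b))
        \<le> (\<integral>\<^sup>+d. max (ennreal 1) (expmax (a - b) m (walk d)) \<partial>iid (incM a b))"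
      by (intro nn_integral_mono max.cobounded2)
    also have "\<dots> \<le> ennreal (1 + B ^ m / 1)"
      by (rule nn_integral_max_expmax_walk[OF ab(1,2) \<open>1 \<le> B\<close> B]) simp
    finally show "(\<integral>\<^sup>+d. expmax (a - b) m (walk d) \<partial>iid (incM a b)) \<le> ennreal (1 + B ^ m / 1)" .
  qed simp
  also have "\<dots> = ennreal ((a / b) ^ n * (1 + B ^ m))"
    using ab \<open>1 \<le> B\<close> ennreal_mult[of "(a / b) ^ n" "1 + B ^ m"] by (simp only: div_by_1) simp
  finally show ?thesis by (simp add: B_def)
qed

subsection \<open>Last passage times with i.i.d. weights\<close>

text \<open>Row \<open>n\<close> of weights enters only at stage \<open>Suc n\<close>: for positive
  \<open>n\<close>, \<open>lpp_profile W n\<close> collects passage times to level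
  \<open>n - 1\<close>, with the weight of the end vertex included.\<close>

primrec lpp_profile :: "(nat \<Rightarrow> nat \<Rightarrow> real) \<Rightarrow> nat \<Rightarrow> nat \<Rightarrow> real" where
  "lpp_profile W 0 = (\<lambda>_. 0)"
| "lpp_profile W (Suc n) = step (W n) (lpp_profile W n)"

text \<open>The level \<open>n\<close> is the coordinate sum. The offset \<open>c\<close> moves a
  chosen window to nonnegative indices, and the predecessors of site \<open>k\<close> have indices
  \<open>k\<close> and \<open>Suc k\<close>, as in \<open>step\<close>.\<close>

definition level_vertex :: "int \<Rightarrow> nat \<Rightarrow> nat \<Rightarrow> int \<times> int" where
  "level_vertex c n k = (int n + int k - c, c - int k)"

lemma level_vertex_pred:
  assumes "level_vertex c (Suc n) k - u \<in> {(1, 0), (0, 1)}"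
  shows "u = level_vertex c n k \<or> u = level_vertex c n (Suc k)"
  using assms by (cases u) (auto simp: level_vertex_def)

lemma measurable_lpp_profile:
  assumes "\<And>m. (\<lambda>x. W x m) \<in> measurable N seqM"
  shows "(\<lambda>x. lpp_profile (W x) n) \<in> measurable N seqM"
proof (induction n)
  case 0
  show ?case by (intro measurable_seqI) simp
next
  case (Suc n)
  then show ?case using assms[of n] by (simp add: measurable_step)
qed

lemma lpp_profile_cong: "(\<And>m. m < n \<Longrightarrow> W m = W' m) \<Longrightarrow> lpp_profile W n = lpp_profile W' n"
  by (induction n) auto

lemma path_sum_le_lpp_profile:
  assumes "up_right_path p" "hd p \<in> antidiag" "last p = level_vertex c n k"
  shows "(\<Sum>v\<leftarrow>p. w v) \<le> lpp_profile (\<lambda>m j. w (level_vertex c m j)) (Suc n) k"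
  using assms
proof (induction p arbitrary: n k rule: rev_induct)
  case Nil
  then show ?case by (simp add: up_right_path_def)
next
  case (snoc v q)
  then have v: "v = level_vertex c n k" by simp
  show ?case
  proof (cases "q = []")
    case True
    with snoc.prems have "n = 0" by (auto simp: level_vertex_def antidiag_def)
    then show ?thesis using True v by (simp add: step_def)
  next
    case False
    with snoc.prems have q: "up_right_path q" "hd q \<in> antidiag" and step: "v - last q \<in> {(1, 0), (0, 1)}"
      by (auto simp: up_right_path_def successively_append_iff)
    have "0 \<le> fst (last q) + snd (last q)"
      using up_right_path_level[OF q(1)] q(2) by (auto simp: antidiag_def)
    moreover have "fst v + snd v = fst (last q) + snd (last q) + 1"
      using step by (cases v; cases "last q") (auto simp: algebra_simps)
    moreover have "fst v + snd v = int n" by (simp add: v level_vertex_def)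
    ultimately obtain l where n: "n = Suc l" by (cases n) auto
    have "last q = level_vertex c l k \<or> last q = level_vertex c l (Suc k)"
      using step unfolding v n by (rule level_vertex_pred)
    then have "(\<Sum>v\<leftarrow>q. w v) \<le> max (lpp_profile (\<lambda>m j. w (level_vertex c m j)) n k)
        (lpp_profile (\<lambda>m j. w (level_vertex c m j)) n (Suc k))"
      using snoc.IH[OF q] n by (auto simp: le_max_iff_disj)
    then show ?thesis by (simp add: v step_def)
  qed
qed

text \<open>Since the last weight is excluded, a path counts up to its penultimate vertex, which
  lies on level \<open>n - 1\<close> at index \<open>k\<close> or \<open>Suc k\<close>. For
  \<open>0 < n\<close> such a vertex exists.\<close>

lemma line_to_point_lpp_le_lpp_profile:
  fixes w :: "int \<times> int \<Rightarrow> real" and c :: int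
  defines "G \<equiv> lpp_profile (\<lambda>m j. w (level_vertex c m j))"
  assumes "0 < n"
  shows "line_to_point_lpp w (level_vertex c n k) \<le> max (G n k) (G n (Suc k))"
proof -
  let ?v = "level_vertex c n k"
  have level: "fst ?v + snd ?v = int n" by (simp add: level_vertex_def)
  have "path_weight w p \<le> max (G n k) (G n (Suc k))" if "p \<in> line_to_point_paths ?v" for p
  proof -
    have p: "up_right_path p" "hd p \<in> antidiag" "last p = ?v"
      using that by (auto simp: line_to_point_paths_def)
    have "p \<noteq> []" using p(1) by (simp add: up_right_path_def)
    then have split: "p = butlast p @ [?v]" using p(3) by (metis append_butlast_last_id)
    have ne: "butlast p \<noteq> []"
    proof
      assume "butlast p = []"
      then have "?v \<in> antidiag" using split p(2) by (metis append_Nil list.sel(1))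
      then show False using level \<open>0 < n\<close> by (auto simp: antidiag_def)
    qed
    have "up_right_path (butlast p @ [?v])" "hd (butlast p @ [?v]) \<in> antidiag"
      using p split by simp_all
    then have q: "up_right_path (butlast p)" "hd (butlast p) \<in> antidiag"
      and step: "?v - last (butlast p) \<in> {(1, 0), (0, 1)}"
      using ne by (auto simp: up_right_path_def successively_append_iff)
    obtain l where n: "n = Suc l" using \<open>0 < n\<close> by (cases n) auto
    have "last (butlast p) = level_vertex c l k \<or> last (butlast p) = level_vertex c l (Suc k)"
      using step unfolding n by (rule level_vertex_pred)
    then show ?thesis
      using path_sum_le_lpp_profile[OF q, of c l _ w] n
      by (auto simp: path_weight_def le_max_iff_disj G_def)
  qed
  then show ?thesis
    unfolding line_to_point_lpp_def
    using finite_line_to_point_paths line_to_point_paths_nonempty[OF level] by (subst Max_le_iff) auto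
qed

context
  fixes M :: "'a measure" and X :: "int \<times> int \<Rightarrow> 'a \<Rightarrow> real"
  assumes M: "prob_space M"
    and indep: "prob_space.indep_vars M (\<lambda>_. borel) X UNIV"
    and exp1: "\<And>v. distributed M lborel (X v) (exponential_density 1)"
begin

interpretation prob_space M by (rule M)

lemma measurable_weight [measurable]: "X v \<in> borel_measurable M"
  using distributed_measurable[OF exp1[of v]] by simp

lemma distr_weight: "distr M borel (X v) = expM 1"
proof -
  have "distr M borel (X v) = distr M lborel (X v)" by (rule distr_cong) auto
  then show ?thesis using distributed_distr_eq_density[OF exp1[of v]] by (simp add: expM_def)
qed

section \<open>Law of a row of weights and its independence of the past\<close>

lemma measurable_weights: "(\<lambda>\<omega> k. X (h k) \<omega>) \<in> measurable M seqM"
  by (intro measurable_seqI) simp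

lemma measurable_profile:
  "(\<lambda>\<omega>. lpp_profile (\<lambda>m j. X (level_vertex c m j) \<omega>) n) \<in> measurable M seqM"
  by (intro measurable_lpp_profile measurable_weights)

lemma distr_level_weights: "distr M seqM (\<lambda>\<omega> k. X (level_vertex c n k) \<omega>) = iid (expM 1)"
proof -
  let ?P = "\<lambda>\<mu>. PiM (UNIV :: (int \<times> int) set) (\<lambda>_. \<mu> :: real measure)"
  have joint: "distr M (?P borel) (\<lambda>\<omega> v. X v \<omega>) = ?P (expM 1)"
    using indep by (subst (asm) indep_vars_iff_distr_eq_PiM) (auto simp: distr_weight restrict_UNIV)
  have "iid (expM 1) = distr (?P (expM 1)) (iid (expM 1)) (\<lambda>r k. r (level_vertex c n k))"
    using distr_PiM_reindex[of UNIV "\<lambda>_. expM 1" "level_vertex c n" UNIV]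
    by (simp add: prob_space_expM inj_def level_vertex_def restrict_UNIV)
  also have "\<dots> = distr (distr M (?P borel) (\<lambda>\<omega> v. X v \<omega>)) seqM (\<lambda>r k. r (level_vertex c n k))"
    unfolding joint by (rule distr_cong) simp_all
  also have "\<dots> = distr M seqM (\<lambda>\<omega> k. X (level_vertex c n k) \<omega>)"
  proof (subst distr_distr)
    show "(\<lambda>r k. r (level_vertex c n k)) \<in> measurable (?P borel) seqM"
      by (intro measurable_seqI measurable_component_singleton) simp
    show "(\<lambda>\<omega> v. X v \<omega>) \<in> measurable M (?P borel)"
      by (intro measurable_PiM_single') auto
  qed (simp add: comp_def)
  finally show ?thesis ..
qed

text \<open>The row lives on the vertices with coordinate sum \<open>n\<close>, the profile on those
  with smaller sum, and these index sets are disjoint.\<close>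

lemma indep_level_weights_profile:
  "indep_var seqM (\<lambda>\<omega> k. X (level_vertex c n k) \<omega>)
    seqM (\<lambda>\<omega>. lpp_profile (\<lambda>m j. X (level_vertex c m j) \<omega>) n)"
proof -
  define A where "A = {v :: int \<times> int. fst v + snd v = int n}"
  define B where "B = {v :: int \<times> int. fst v + snd v < int n}"
  have mem: "level_vertex c n k \<in> A" "m < n \<Longrightarrow> level_vertex c m k \<in> B" for k m
    by (auto simp: A_def B_def level_vertex_def)
  define F where "F r k = r (level_vertex c n k)" for r :: "int \<times> int \<Rightarrow> real" and k
  \<comment> \<open>Rows from level \<open>n\<close> on lie outside \<open>B\<close>; the default 0
    makes \<open>H\<close> a measurable function of the coordinates in \<open>B\<close>, and stage
    \<open>n\<close> never reads those rows.\<close>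
  define H where "H r = lpp_profile (\<lambda>m j. if m < n then r (level_vertex c m j) else 0) n" for r :: "int \<times> int \<Rightarrow> real"
  have F: "F \<in> measurable (PiM A (\<lambda>_. borel)) seqM"
    unfolding F_def[abs_def] using mem by (intro measurable_seqI measurable_component_singleton)
  have H: "H \<in> measurable (PiM B (\<lambda>_. borel)) seqM"
    unfolding H_def[abs_def]
  proof (intro measurable_lpp_profile measurable_seqI)
    fix m k
    show "(\<lambda>r. if m < n then r (level_vertex c m k) else 0) \<in> borel_measurable (PiM B (\<lambda>_. borel))"
      using mem(2)[of m k] by (cases "m < n") (auto intro!: measurable_component_singleton)
  qed
  have "indep_var seqM (F \<circ> (\<lambda>\<omega>. restrict (\<lambda>i. X i \<omega>) A)) seqM (H \<circ> (\<lambda>\<omega>. restrict (\<lambda>i. X i \<omega>) B))"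
    by (rule indep_var_compose[OF indep_var_restrict[OF indep] F H]) (auto simp: A_def B_def)
  moreover have "F \<circ> (\<lambda>\<omega>. restrict (\<lambda>i. X i \<omega>) A) = (\<lambda>\<omega> k. X (level_vertex c n k) \<omega>)"
    using mem by (auto simp: F_def fun_eq_iff)
  moreover have "H \<circ> (\<lambda>\<omega>. restrict (\<lambda>i. X i \<omega>) B) = (\<lambda>\<omega>. lpp_profile (\<lambda>m j. X (level_vertex c m j) \<omega>) n)"
  proof
    fix \<omega>
    show "(H \<circ> (\<lambda>\<omega>. restrict (\<lambda>i. X i \<omega>) B)) \<omega> = lpp_profile (\<lambda>m j. X (level_vertex c m j) \<omega>) n"
      unfolding o_apply H_def using mem by (intro lpp_profile_cong) (auto simp: fun_eq_iff)
  qed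
  ultimately show ?thesis by simp
qed

text \<open>The Markov property: the newest row is independent of the profile below, so integrating
  it out replaces \<open>f\<close> by \<open>stepE f\<close>. Hence the induction runs over all
  functionals.\<close>

lemma nn_integral_lpp_profile:
  assumes "f \<in> borel_measurable seqM"
  shows "(\<integral>\<^sup>+\<omega>. f (lpp_profile (\<lambda>m j. X (level_vertex c m j) \<omega>) n) \<partial>M) = (stepE ^^ n) f (\<lambda>_. 0)"
  using assms
proof (induction n arbitrary: f)
  case 0
  then show ?case by (simp add: emeasure_space_1)
next
  case (Suc n)
  note [measurable] = Suc.prems measurable_profile measurable_weights
  let ?G = "\<lambda>\<omega>. lpp_profile (\<lambda>m j. X (level_vertex c m j) \<omega>) n"
  let ?w = "\<lambda>\<omega> k. X (level_vertex c n k) \<omega>"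
  interpret W: prob_space "iid (expM 1)" by (intro prob_space_iid prob_space_expM) simp
  interpret G: prob_space "distr M seqM ?G" by (rule prob_space_distr) simp
  interpret pair_sigma_finite "iid (expM 1)" "distr M seqM ?G" ..
  have joint: "distr M (seqM \<Otimes>\<^sub>M seqM) (\<lambda>\<omega>. (?w \<omega>, ?G \<omega>)) = iid (expM 1) \<Otimes>\<^sub>M distr M seqM ?G"
    using indep_level_weights_profile[of c n] unfolding indep_var_distribution_eq distr_level_weights by simp
  have "(\<integral>\<^sup>+\<omega>. f (lpp_profile (\<lambda>m j. X (level_vertex c m j) \<omega>) (Suc n)) \<partial>M)
      = (\<integral>\<^sup>+p. f (step (fst p) (snd p)) \<partial>distr M (seqM \<Otimes>\<^sub>M seqM) (\<lambda>\<omega>. (?w \<omega>, ?G \<omega>)))"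
    by (subst nn_integral_distr) auto
  also have "\<dots> = (\<integral>\<^sup>+g. stepE f g \<partial>distr M seqM ?G)"
    unfolding joint stepE_def by (subst nn_integral_snd[symmetric]) (auto simp: split_beta')
  also have "\<dots> = (\<integral>\<^sup>+\<omega>. stepE f (?G \<omega>) \<partial>M)"
    by (subst nn_integral_distr) auto
  also have "\<dots> = (stepE ^^ n) (stepE f) (\<lambda>_. 0)"
    by (rule Suc.IH) measurable
  finally show ?case by (simp only: funpow_Suc_right o_apply)
qed

text \<open>Markov's inequality for the exponential of the maximum over the window, with
  \<open>a\<close>, \<open>b\<close> chosen so that \<open>a - b = \<theta>\<close>. The condition
  \<open>a < 2 * b\<close> becomes \<open>\<theta> < 1 / 3\<close>.\<close>

lemma prob_lpp_profile_le:
  assumes "0 < \<theta>" "\<theta> < 1 / 3"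
  shows "prob {\<omega> \<in> space M. \<exists>j\<le>m. x \<le> lpp_profile (\<lambda>m j. X (level_vertex c m j) \<omega>) n j}
    \<le> exp (- \<theta> * x) * ((1 + \<theta>) / (1 - \<theta>)) ^ n * (1 + ((1 - \<theta>\<^sup>2) / (1 - 9 * \<theta>\<^sup>2)) ^ m)"
proof -
  define a where "a = (1 + \<theta>) / 2"
  define b where "b = (1 - \<theta>) / 2"
  have ab: "0 < a" "0 < b" "a + b = 1" "b \<le> a" "a < 2 * b" and diff: "a - b = \<theta>"
    using assms by (auto simp: a_def b_def field_simps)
  have quot: "a / b = (1 + \<theta>) / (1 - \<theta>)"
    using assms unfolding a_def b_def by (simp add: field_simps)
  have prod: "a * b / ((2 * b - a) * (2 * a - b)) = (1 - \<theta>\<^sup>2) / (1 - 9 * \<theta>\<^sup>2)"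
  proof -
    have "a * b = (1 - \<theta>\<^sup>2) / 4" "(2 * b - a) * (2 * a - b) = (1 - 9 * \<theta>\<^sup>2) / 4"
      by (simp_all add: a_def b_def power2_eq_square field_simps)
    then show ?thesis by (simp only: divide_divide_eq_left divide_divide_eq_right)
  qed
  let ?G = "\<lambda>\<omega>. lpp_profile (\<lambda>m j. X (level_vertex c m j) \<omega>) n"
  let ?K = "((1 + \<theta>) / (1 - \<theta>)) ^ n * (1 + ((1 - \<theta>\<^sup>2) / (1 - 9 * \<theta>\<^sup>2)) ^ m)"
  note [measurable] = measurable_profile measurable_seqD[OF measurable_profile]
  have \<theta>2: "9 * \<theta>\<^sup>2 < 1"
    using assms mult_strict_mono[of \<theta> "1/3" \<theta> "1/3"] by (simp add: power2_eq_square)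
  then have K: "0 \<le> ?K"
    using assms by (intro mult_nonneg_nonneg add_nonneg_nonneg zero_le_power divide_nonneg_nonneg) auto
  have "emeasure M {\<omega> \<in> space M. \<exists>j\<le>m. x \<le> ?G \<omega> j}
      \<le> emeasure M {\<omega> \<in> space M. 1 \<le> ennreal (exp (- \<theta> * x)) * expmax \<theta> m (?G \<omega>)}"
  proof (rule emeasure_mono)
    show "{\<omega> \<in> space M. \<exists>j\<le>m. x \<le> ?G \<omega> j} \<subseteq> {\<omega> \<in> space M. 1 \<le> ennreal (exp (- \<theta> * x)) * expmax \<theta> m (?G \<omega>)}"
    proof safe
      fix \<omega> j assume "j \<le> m" "x \<le> ?G \<omega> j"
      then have "1 \<le> ennreal (exp (- \<theta> * x)) * ennreal (exp (\<theta> * ?G \<omega> j))"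
        using assms by (simp add: ennreal_mult[symmetric] exp_add[symmetric])
      also have "\<dots> \<le> ennreal (exp (- \<theta> * x)) * expmax \<theta> m (?G \<omega>)"
        by (intro mult_left_mono expmax_ge \<open>j \<le> m\<close>) simp
      finally show "1 \<le> ennreal (exp (- \<theta> * x)) * expmax \<theta> m (?G \<omega>)" .
    qed
  qed measurable
  also have "\<dots> \<le> ennreal (exp (- \<theta> * x)) * (\<integral>\<^sup>+\<omega>. expmax \<theta> m (?G \<omega>) * indicator (space M) \<omega> \<partial>M)"
    by (rule nn_integral_Markov_inequality) measurable
  also have "(\<integral>\<^sup>+\<omega>. expmax \<theta> m (?G \<omega>) * indicator (space M) \<omega> \<partial>M) = (\<integral>\<^sup>+\<omega>. expmax \<theta> m (?G \<omega>) \<partial>M)"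
    by (intro nn_integral_cong) simp
  also have "\<dots> = (stepE ^^ n) (expmax \<theta> m) (\<lambda>_. 0)"
    by (rule nn_integral_lpp_profile) measurable
  also have "\<dots> \<le> ennreal ?K"
    using iterate_stepE_expmax_le[OF ab, of n m] unfolding quot prod diff .
  finally have "emeasure M {\<omega> \<in> space M. \<exists>j\<le>m. x \<le> ?G \<omega> j} \<le> ennreal (exp (- \<theta> * x) * ?K)"
    using K by (simp add: ennreal_mult mult_left_mono)
  then show ?thesis
    using K by (simp add: emeasure_eq_measure mult.assoc)
qed

end

subsection \<open>Chernoff and union bounds\<close>

text \<open>\<open>ln ((1 + \<theta>) / (1 - \<theta>)) = 2\<theta> + 2\<theta>^3/3 +
  O(\<theta>^5)\<close>; times \<open>2 * N\<close> this is
  \<open>4 * N * \<theta> + 4/3 * \<tau>^3\<close> up to a vanishing error, absorbed by the summand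
  1.\<close>

lemma eventually_growth_le:
  fixes \<tau> :: real
  assumes "0 < \<tau>"
  shows "\<forall>\<^sub>F N :: nat in sequentially. let \<theta> = \<tau> * real N powr (- 1 / 3) in
    \<theta> < 1 / 6 \<and> ((1 + \<theta>) / (1 - \<theta>)) ^ (2 * N) \<le> exp (4 * real N * \<theta> + 4 / 3 * \<tau> ^ 3 + 1)"
proof -
  have "((\<lambda>x::real. 2 * x * (ln (1 + \<tau> * x powr (- 1 / 3)) - ln (1 - \<tau> * x powr (- 1 / 3)))
      - 4 * x * (\<tau> * x powr (- 1 / 3))) \<longlongrightarrow> 4 / 3 * \<tau> ^ 3) at_top"
    using assms by (real_asymp simp: power3_eq_cube)
  from order_tendstoD(2)[OF filterlim_compose[OF this filterlim_real_sequentially], of "4 / 3 * \<tau> ^ 3 + 1"]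
  have growth: "\<forall>\<^sub>F N in sequentially. 2 * real N * (ln (1 + \<tau> * real N powr (- 1 / 3)) - ln (1 - \<tau> * real N powr (- 1 / 3)))
      - 4 * real N * (\<tau> * real N powr (- 1 / 3)) < 4 / 3 * \<tau> ^ 3 + 1"
    by simp
  have "(\<lambda>N. \<tau> * real N powr (- 1 / 3)) \<longlonglongrightarrow> 0" by real_asymp
  then have small: "\<forall>\<^sub>F N in sequentially. \<tau> * real N powr (- 1 / 3) < 1 / 6"
    by (rule order_tendstoD) simp
  show ?thesis
    using growth small eventually_gt_at_top[of 0]
  proof eventually_elim
    case (elim N)
    define \<theta> where "\<theta> = \<tau> * real N powr (- 1 / 3)"
    have \<theta>: "0 < \<theta>" "\<theta> < 1 / 6" using elim assms by (auto simp: \<theta>_def)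
    have "(1 + \<theta>) / (1 - \<theta>) = exp (ln (1 + \<theta>) - ln (1 - \<theta>))"
      using \<theta> by (simp add: exp_diff)
    then have "((1 + \<theta>) / (1 - \<theta>)) ^ (2 * N) = exp (real (2 * N) * (ln (1 + \<theta>) - ln (1 - \<theta>)))"
      by (simp only: exp_of_nat_mult)
    also have "\<dots> \<le> exp (4 * real N * \<theta> + 4 / 3 * \<tau> ^ 3 + 1)"
      using elim(1) unfolding \<theta>_def[symmetric] by simp
    finally show ?case using \<theta> unfolding Let_def \<theta>_def[symmetric] by simp
  qed
qed

text \<open>The base is \<open>1 + 8\<theta>^2\<close> to second order. Doubling 8 to 16 absorbs the
  higher orders once \<open>18\<theta>^2 \<le> 1\<close>.\<close>

lemma second_moment_power_le:
  fixes \<theta> :: real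
  assumes "0 < \<theta>" "\<theta> < 1 / 6"
  shows "((1 - \<theta>\<^sup>2) / (1 - 9 * \<theta>\<^sup>2)) ^ k \<le> exp (16 * \<theta>\<^sup>2 * real k)"
proof -
  have "\<theta>\<^sup>2 < (1 / 6)\<^sup>2" using assms by (intro power_strict_mono) auto
  then have sq: "18 * \<theta>\<^sup>2 \<le> 1" by (simp add: power2_eq_square)
  then have "0 \<le> \<theta>\<^sup>2 * (8 - 144 * \<theta>\<^sup>2)" by (intro mult_nonneg_nonneg) auto
  then have "1 - \<theta>\<^sup>2 \<le> (1 + 16 * \<theta>\<^sup>2) * (1 - 9 * \<theta>\<^sup>2)" by (simp add: algebra_simps)
  then have "(1 - \<theta>\<^sup>2) / (1 - 9 * \<theta>\<^sup>2) \<le> 1 + 16 * \<theta>\<^sup>2"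
    using sq by (simp add: pos_divide_le_eq)
  also have "\<dots> \<le> exp (16 * \<theta>\<^sup>2)" by (rule exp_ge_add_one_self)
  finally have "((1 - \<theta>\<^sup>2) / (1 - 9 * \<theta>\<^sup>2)) ^ k \<le> exp (16 * \<theta>\<^sup>2) ^ k"
    using sq by (intro power_mono divide_nonneg_nonneg) auto
  then show ?thesis by (simp add: exp_of_nat_mult[symmetric] mult.commute)
qed

text \<open>The number of windows is of order \<open>t\<close>, which leaves
  \<open>t powr (- 3/2 * \<epsilon>)\<close>. The factor \<open>exp (48 * ...)\<close> is
  \<open>t\<close> to a vanishing power and fits into the spare
  \<open>t powr (- \<epsilon> / 2)\<close>; hence \<open>\<gamma> = \<epsilon>\<close> will
  do.\<close>

lemma eventually_union_bound_le:
  fixes \<epsilon> :: real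
  assumes "0 < \<epsilon>"
  shows "\<forall>\<^sub>F t in at_top.
    (2 * t + 1) * (2 * exp 1 * exp (48 * (3 / 8 * ln t) powr (2 / 3)) * t powr (- 1 - 3 / 2 * \<epsilon>)) \<le> t powr - \<epsilon>"
  using assms by real_asymp

lemma exponent_identity: "(3 / 8) powr (1 / 3) * 2 powr (4 / 3) * (3 / 4) powr (2 / 3) = (3 / 2 :: real)"
proof -
  have "8 powr (1 / 3) = (2 :: real)" using powr_powr[of 2 3 "1 / 3"] by simp
  moreover have "4 powr (2 / 3) = (2 :: real) powr (4 / 3)" using powr_powr[of 2 2 "2 / 3 :: real"] by simp
  moreover have "3 powr (1 / 3) * 3 powr (2 / 3) = (3 :: real)" by (simp add: powr_add[symmetric])
  ultimately show ?thesis by (simp add: powr_divide)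
qed

lemma chernoff_exponent:
  fixes L \<epsilon> :: real
  assumes "0 < N" "0 < L"
  shows "(3 / 8 * L) powr (1 / 3) * real N powr (- 1 / 3) *
      ((3 / 4) powr (2 / 3) * (1 + \<epsilon>) * (2 powr (4 / 3) * real N powr (1 / 3) * L powr (2 / 3)))
    = 3 / 2 * (1 + \<epsilon>) * L"
proof -
  have regroup: "(p * l) * n * (r * e * (q * n' * l')) = (p * q * r) * e * K"
    if "n * n' = 1" "l * l' = K" for p q r e n n' l l' K :: real
  proof -
    have "(p * l) * n * (r * e * (q * n' * l')) = (p * q * r) * e * (n * n') * (l * l')"
      by (simp add: mult_ac)
    then show ?thesis using that by simp
  qed
  have "real N powr (- 1 / 3) * real N powr (1 / 3) = 1" "L powr (1 / 3) * L powr (2 / 3) = L"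
    using assms by (simp_all add: powr_add[symmetric])
  from regroup[OF this] show ?thesis
    unfolding powr_mult[of "3 / 8" L] exponent_identity[symmetric] .
qed

text \<open>The integer displacement \<open>l\<close> of the end point is sorted into blocks of
  length \<open>m\<close>, and all end points of a block are read off one profile with a common
  offset. As \<open>(2 * N) powr (2/3) \<le> 2 * m\<close>, block numbers are at most
  \<open>2 * t\<close>. The index reaches \<open>Suc m\<close> because excluding the last weight
  brings in the right neighbour.\<close>

lemma T_star_le_lpp_profile:
  fixes w :: "int \<times> int \<Rightarrow> real" and t :: real
  assumes "0 < N" "0 < m" and s: "0 \<le> s" "s \<le> t" and m: "real N powr (2 / 3) \<le> real m"
  obtains b j where "real b \<le> 2 * t" "j \<le> Suc m"
    "T_star w N s \<le> lpp_profile (\<lambda>i k. w (level_vertex (int N + int (b * m + m)) i k)) (2 * N) j"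
proof -
  define l where "l = nat \<lfloor>s * (2 * real N) powr (2 / 3)\<rfloor>"
  define b where "b = l div m"
  \<comment> \<open>Site indices grow towards the lower right, so the index is counted back from the
    far end of the block.\<close>
  define k where "k = b * m + m - l"
  define c where "c = int N + int (b * m + m)"
  define G where "G = lpp_profile (\<lambda>i k. w (level_vertex c i k)) (2 * N)"
  have l: "int l = \<lfloor>s * (2 * real N) powr (2 / 3)\<rfloor>" using s by (simp add: l_def)
  have "l = b * m + l mod m" by (simp add: b_def)
  moreover have "l mod m < m" using \<open>0 < m\<close> by simp
  ultimately have lb: "b * m \<le> l" "l \<le> b * m + m" by linarith+
  have endp: "endpoint N s = level_vertex c (2 * N) k"
    using lb by (simp add: endpoint_def l[symmetric] level_vertex_def c_def k_def of_nat_diff)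
  have "k \<le> m" using lb by (simp add: k_def)
  have "T_star w N s \<le> max (G k) (G (Suc k))"
    unfolding T_star_def endp G_def by (rule line_to_point_lpp_le_lpp_profile) (use \<open>0 < N\<close> in simp)
  then have "T_star w N s \<le> G k \<or> T_star w N s \<le> G (Suc k)"
    by (simp add: le_max_iff_disj)
  then obtain j where j: "j \<le> Suc m" "T_star w N s \<le> G j"
    using \<open>k \<le> m\<close> by (metis Suc_le_mono le_SucI)
  have "real b * real m \<le> real l" using lb(1) by (metis of_nat_le_iff of_nat_mult)
  also have "real l \<le> s * (2 * real N) powr (2 / 3)"
    using l by (metis of_int_floor_le of_int_of_nat_eq)
  also have "\<dots> \<le> t * (2 * real m)"
  proof (rule mult_mono)
    have "(2 * real N) powr (2 / 3) = 2 powr (2 / 3) * real N powr (2 / 3)" by (simp add: powr_mult)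
    also have "\<dots> \<le> 2 * real m"
    proof (rule mult_mono)
      show "2 powr (2 / 3) \<le> (2 :: real)" using powr_mono[of "2 / 3" 1 "2 :: real"] by simp
    qed (use m in auto)
    finally show "(2 * real N) powr (2 / 3) \<le> 2 * real m" .
  qed (use s in auto)
  finally have "real b * real m \<le> (2 * t) * real m" by (simp add: mult_ac)
  then have "real b \<le> 2 * t" using \<open>0 < m\<close> by simp
  with j show ?thesis by (intro that[of b j]) (simp_all add: G_def c_def)
qed

theorem theorem2p1:
  fixes M :: "'a measure" and X :: "int \<times> int \<Rightarrow> 'a \<Rightarrow> real" and \<epsilon> :: real
  assumes "prob_space M"
    and "prob_space.indep_vars M (\<lambda>_. borel) X UNIV"
    and "\<And>v. distributed M lborel (X v) (exponential_density 1)"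
    and "\<epsilon> > 0"
  shows "\<exists>\<gamma>>0. \<forall>\<^sub>F t :: real in at_top. \<forall>\<^sub>F N in sequentially.
    measure M {\<omega> \<in> space M.
        Max ((\<lambda>s. (T_star (\<lambda>v. X v \<omega>) N s - 4 * real N) /
                    (2 powr (4/3) * real N powr (1/3) * ln t powr (2/3))) ` {0..t})
        \<ge> (3/4) powr (2/3) * (1 + \<epsilon>)}
      \<le> t powr - \<gamma>"
proof (intro exI[of _ \<epsilon>] conjI)
  interpret prob_space M by fact
  let ?thr = "(3/4) powr (2/3) * (1 + \<epsilon>)"
  show "\<forall>\<^sub>F t :: real in at_top. \<forall>\<^sub>F N in sequentially.
    prob {\<omega> \<in> space M.
        Max ((\<lambda>s. (T_star (\<lambda>v. X v \<omega>) N s - 4 * real N) /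
                    (2 powr (4/3) * real N powr (1/3) * ln t powr (2/3))) ` {0..t})
        \<ge> ?thr} \<le> t powr - \<epsilon>"
    using eventually_union_bound_le[OF \<open>\<epsilon> > 0\<close>] eventually_gt_at_top[of 1]
  proof eventually_elim
    case (elim t)
    define L where "L = ln t"
    \<comment> \<open>At \<epsilon> = 0 the exponent is
      \<open>4/3 * \<tau>^3 - (3 * L) powr (2/3) * \<tau>\<close>. Its minimum over positive \<tau>
      is at \<open>\<tau>^3 = 3/8 * L\<close>, with value \<open>- L\<close>: just enough to beat
      the number of windows.\<close>
    define \<tau> where "\<tau> = (3 / 8 * L) powr (1 / 3)"
    have L: "0 < L" using elim by (simp add: L_def)
    then have \<tau>: "0 < \<tau>" by (simp add: \<tau>_def)
    have \<tau>3: "4 / 3 * \<tau> ^ 3 = L / 2"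
      using L by (simp add: \<tau>_def powr_power)
    have \<tau>2: "\<tau>\<^sup>2 = (3 / 8 * L) powr (2 / 3)"
      using L by (simp add: \<tau>_def powr_power)
    show ?case
      using eventually_growth_le[OF \<tau>] eventually_gt_at_top[of 0]
    proof eventually_elim
      case N: (elim N)
      define \<theta> where "\<theta> = \<tau> * real N powr (- 1 / 3)"
      have \<theta>: "0 < \<theta>" "\<theta> < 1 / 6"
        and growth: "((1 + \<theta>) / (1 - \<theta>)) ^ (2 * N) \<le> exp (4 * real N * \<theta> + L / 2 + 1)"
        using N \<tau> unfolding \<theta>_def Let_def \<tau>3 by auto
      define D where "D = 2 powr (4/3) * real N powr (1/3) * L powr (2/3)"
      have "0 < D" using N L by (simp add: D_def)
      define x where "x = 4 * real N + ?thr * D"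
      have \<theta>x: "\<theta> * x = 4 * real N * \<theta> + 3 / 2 * (1 + \<epsilon>) * L"
        using chernoff_exponent[OF N(2) L, of \<epsilon>]
        by (simp add: x_def distrib_left \<theta>_def \<tau>_def D_def mult_ac)
      define m where "m = nat \<lceil>real N powr (2 / 3)\<rceil>"
      have N1: "1 \<le> real N powr (2 / 3)" using N(2) by (simp add: ge_one_powr_ge_zero)
      have m: "real N powr (2 / 3) \<le> real m" "real m \<le> real N powr (2 / 3) + 1" "0 < m"
        using N1 unfolding m_def by linarith+
      define G where "G b \<omega> = lpp_profile (\<lambda>i k. X (level_vertex (int N + int (b * m + m)) i k) \<omega>) (2 * N)" for b \<omega>
      define E where "E b = {\<omega> \<in> space M. \<exists>j\<le>Suc m. x \<le> G b \<omega> j}" for b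
      have [measurable]: "(\<lambda>\<omega>. G b \<omega> j) \<in> borel_measurable M" for b j
        unfolding G_def by (rule measurable_seqD[OF measurable_profile[OF assms(1-3)]])
      have E_sets: "E b \<in> sets M" for b unfolding E_def by measurable
      let ?B = "2 * exp 1 * exp (48 * (3 / 8 * ln t) powr (2 / 3)) * t powr (- 1 - 3 / 2 * \<epsilon>)"
      have E_prob: "prob (E b) \<le> ?B" for b
      proof -
        \<comment> \<open>\<open>Suc m\<close> is at most \<open>N powr (2/3) + 2\<close>, hence at
          most \<open>3 * N powr (2/3)\<close>, and \<theta> scales as \<open>N powr (-1/3)\<close>,
          so \<open>N\<close> cancels; the constant 48 is 16 times 3.\<close>
        have "\<theta>\<^sup>2 * real (Suc m) \<le> \<theta>\<^sup>2 * (3 * real N powr (2 / 3))"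
          using m N1 by (intro mult_left_mono) auto
        also have "\<dots> = 3 * \<tau>\<^sup>2"
          using N(2) by (simp add: \<theta>_def power_mult_distrib powr_power powr_add[symmetric])
        finally have "16 * \<theta>\<^sup>2 * real (Suc m) \<le> 48 * \<tau>\<^sup>2"
          unfolding mult.assoc by linarith
        then have "((1 - \<theta>\<^sup>2) / (1 - 9 * \<theta>\<^sup>2)) ^ Suc m \<le> exp (48 * \<tau>\<^sup>2)"
          using second_moment_power_le[OF \<theta>, of "Suc m"]
          by (elim order_trans) (simp only: exp_le_cancel_iff)
        moreover have "1 \<le> exp (48 * \<tau>\<^sup>2)" by simp
        ultimately have R: "1 + ((1 - \<theta>\<^sup>2) / (1 - 9 * \<theta>\<^sup>2)) ^ Suc m \<le> 2 * exp (48 * \<tau>\<^sup>2)" by linarith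
        have "prob (E b) \<le> exp (- \<theta> * x) * ((1 + \<theta>) / (1 - \<theta>)) ^ (2 * N) * (1 + ((1 - \<theta>\<^sup>2) / (1 - 9 * \<theta>\<^sup>2)) ^ Suc m)"
          unfolding E_def G_def using \<theta> by (intro prob_lpp_profile_le[OF assms(1-3)]) auto
        also have "\<dots> \<le> exp (- \<theta> * x) * exp (4 * real N * \<theta> + L / 2 + 1) * (2 * exp (48 * \<tau>\<^sup>2))"
        proof (rule mult_mono[OF mult_left_mono[OF growth] R])
          have "\<theta>\<^sup>2 < (1 / 6)\<^sup>2" using \<theta> by (intro power_strict_mono) auto
          then have "0 \<le> (1 - \<theta>\<^sup>2) / (1 - 9 * \<theta>\<^sup>2)"
            by (intro divide_nonneg_nonneg) (auto simp: power2_eq_square)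
          then show "0 \<le> 1 + ((1 - \<theta>\<^sup>2) / (1 - 9 * \<theta>\<^sup>2)) ^ Suc m"
            by (intro add_nonneg_nonneg zero_le_power) auto
        qed auto
        \<comment> \<open>The terms \<open>4 * N * \<theta>\<close> cancel, and \<open>L / 2 - 3/2 *
          (1 + \<epsilon>) * L = (- 1 - 3/2 * \<epsilon>) * L\<close>.\<close>
        also have "\<dots> = 2 * exp (48 * \<tau>\<^sup>2) * exp (1 + (- 1 - 3 / 2 * \<epsilon>) * L)"
        proof -
          have "- \<theta> * x + (4 * real N * \<theta> + L / 2 + 1) = 1 + (- 1 - 3 / 2 * \<epsilon>) * L"
            using \<theta>x by (simp add: algebra_simps)
          then have "exp (- \<theta> * x) * exp (4 * real N * \<theta> + L / 2 + 1) = exp (1 + (- 1 - 3 / 2 * \<epsilon>) * L)"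
            by (simp only: exp_add[symmetric])
          then show ?thesis by (simp only: mult.commute)
        qed
        also have "\<dots> = ?B"
          using elim(2) by (simp add: exp_add powr_def L_def \<tau>2[unfolded L_def])
        finally show ?thesis .
      qed
      have sub: "{\<omega> \<in> space M.
          Max ((\<lambda>s. (T_star (\<lambda>v. X v \<omega>) N s - 4 * real N) / D) ` {0..t}) \<ge> ?thr}
          \<subseteq> (\<Union>b\<le>nat \<lfloor>2 * t\<rfloor>. E b)"
      proof safe
        fix \<omega> assume \<omega>: "\<omega> \<in> space M"
          and ge: "?thr \<le> Max ((\<lambda>s. (T_star (\<lambda>v. X v \<omega>) N s - 4 * real N) / D) ` {0..t})"
        let ?T = "\<lambda>s. T_star (\<lambda>v. X v \<omega>) N s"
        \<comment> \<open>Finitely many values occur, so the maximum is attained at some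
          \<open>s\<close>, which then determines the block \<open>b\<close> and the site
          \<open>j\<close>.\<close>
        have "finite ((\<lambda>s. (?T s - 4 * real N) / D) ` {0..t})"
          using finite_imageI[OF finite_T_star_range[of "\<lambda>v. X v \<omega>" N t], of "\<lambda>y. (y - 4 * real N) / D"]
          by (simp add: image_image)
        then obtain s where s: "0 \<le> s" "s \<le> t" "?thr \<le> (?T s - 4 * real N) / D"
          using ge elim(2) by (subst (asm) Max_ge_iff) auto
        from s(3) have "x \<le> ?T s" using \<open>0 < D\<close> by (simp add: x_def pos_le_divide_eq)
        moreover obtain b j where "real b \<le> 2 * t" "j \<le> Suc m" "?T s \<le> G b \<omega> j"
          using T_star_le_lpp_profile[OF N(2) m(3) s(1,2) m(1), of "\<lambda>v. X v \<omega>"] unfolding G_def by blast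
        moreover from this have "b \<le> nat \<lfloor>2 * t\<rfloor>" by (simp add: le_nat_floor)
        ultimately show "\<omega> \<in> (\<Union>b\<le>nat \<lfloor>2 * t\<rfloor>. E b)"
          using \<omega> by (auto simp: E_def intro: order_trans)
      qed
      have "prob {\<omega> \<in> space M.
          Max ((\<lambda>s. (T_star (\<lambda>v. X v \<omega>) N s - 4 * real N) / D) ` {0..t}) \<ge> ?thr}
          \<le> prob (\<Union>b\<le>nat \<lfloor>2 * t\<rfloor>. E b)"
        using E_sets by (intro finite_measure_mono[OF sub]) auto
      also have "\<dots> \<le> (\<Sum>b\<le>nat \<lfloor>2 * t\<rfloor>. prob (E b))"
        using E_sets by (intro finite_measure_subadditive_finite) auto
      also have "\<dots> \<le> (\<Sum>b\<le>nat \<lfloor>2 * t\<rfloor>. ?B)" by (intro sum_mono E_prob)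
      also have "\<dots> = (real (nat \<lfloor>2 * t\<rfloor>) + 1) * ?B" by simp
      also have "\<dots> \<le> (2 * t + 1) * ?B"
        using elim(2) by (intro mult_right_mono) auto
      also have "\<dots> \<le> t powr - \<epsilon>" by (rule elim(1))
      finally show ?case by (simp only: D_def L_def)
    qed
  qed
qed (rule \<open>\<epsilon> > 0\<close>)

end
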